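(* Let $\Gamma$ be a countable group with an integer-valued length function $\mathcal{G}$. Assume that $(\Gamma,\mathcal{G})$ satisfies the spherical coarse median inequality with parameter $d_2$ (that is, of rank $d_2+1$) and has almost exact polynomial-exponential growth of spheres with parameters $d$ and $q$. Then the Hardy-Littlewood operator $\mathcal{M}$ satisfies the weak-type $\mathcal{L}(\log\mathcal{L})^{\mathbf{c}}(\Gamma)$ maximal inequality, with $\mathbf{c}=2d_2+d$. In particular, when $d_2=0=d$ the Hardy-Littlewood operator satisfies the weak-type $(1,1)$-maximal inequality in $\ell^1(\Gamma)$.
   Context: A length function on a countable group $\Gamma$ is a function $\mathcal{G}:\Gamma\to[0,\infty)$ which is proper (each set $\{\mathcal{G}<r\}$ is finite), symmetric ($\mathcal{G}(u^{-1})=\mathcal{G}(u)$), subadditive ($\mathcal{G}(uv)\le\mathcal{G}(u)+\mathcal{G}(v)$) and satisfies $\mathcal{G}(e)=0$. Put $d_{\mathcal{G}}(u,v)=\mathcal{G}(u^{-1}v)$, $B_r=\{\gamma:\mathcal{G}(\gamma)<r\}$, and let $S_r=\{\gamma:\mathcal{G}(\gamma)=r\}$ be the spheres, namely the spherical shells $\{\gamma:r\le\mathcal{G}(\gamma)<r+1\}$ of width $1$. $|\cdot|$ of a set denotes cardinality, and $\mathbb{N}_0$ is the set of non-negative integers. Almost exact polynomial-exponential growth of spheres with parameters $(q,d)$, where $q>1$ and $d\ge0$ is an integer: there is $C\ge1$ with $C^{-1}r^dq^r\le|S_r|\le Cr^dq^r$ for all $r\ge1$. Spherical coarse median inequality of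 rank $d_2+1$ (with parameter $d_2\ge0$): there is a constant $C_0>0$ such that, given any $r\in\mathbb{N}_0$, $0\le m\le r$, and $i,j\in\mathbb{N}_0$ satisfying $i=j+r-2m$, any two non-empty sets $E_j\subset S_j$, $F_i\subset S_i$ satisfy $$|\{(x,y)\in E_j\times F_i: d_{\mathcal{G}}(x,y)=r\}|\le C_0r^{d_2}\min\{|S_{r-m}||E_j|,\,|S_m||F_i|\}.$$ Hardy-Littlewood operator: for a fixed $r_0>0$, $\mathcal{M}f(x)=\sup_{r>r_0}\frac{1}{|B_r|}\sum_{u:\,d_{\mathcal{G}}(x,u)<r}|f(u)|$. For $\mathbf{c}>0$, $\mathcal{L}(\log\mathcal{L})^{\mathbf{c}}(\Gamma)$ is the space of functions $f$ on $\Gamma$ with $\sum_{x:\,|f(x)|>\eta}\frac{|f(x)|}{\eta}\left(\log\frac{|f(x)|}{\eta}\right)^{\mathbf{c}}<\infty$ for all $\eta>0$. $\mathcal{M}$ satisfies the weak-type $\mathcal{L}(\log\mathcal{L})^{\mathbf{c}}(\Gamma)$ maximal inequality if there is a constant $K>0$, independent of $f$, such that for every $\eta>0$, $$|\{x:\mathcal{M}f(x)\ge\eta\}|\le K\sum_{x:\,|f(x)|>\eta}\frac{|f(x)|}{\eta}\left(\log\frac{|f(x)|}{\eta}\right)^{\mathbf{c}}.$$ For $\mathbf{c}=0$ this means the weak-type $(1,1)$ maximal inequality: $|\{x:\mathcal{M}f(x)\ge\eta\}|\le\frac{K}{\eta}\|f\|_{\ell^1(\Gamma)}$ for all $\eta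>0$.
   Formalization: For c>0 the printed inequality fails (f the indicator of a large ball); it is stated instead for the set Mf ≥ λη, for every λ>1, with K depending on λ but not on f or η. In the coarse median inequality the factor r^{d_2} is read as 1 at r=0. *)

theory Defs
  imports
    "HOL-Analysis.Analysis"
    "HOL-Algebra.Group"
begin

definition length_function :: "('a, 'b) monoid_scheme \<Rightarrow> ('a \<Rightarrow> real) \<Rightarrow> bool" where
  "length_function \<Gamma> L \<longleftrightarrow>
     (\<forall>u\<in>carrier \<Gamma>. 0 \<le> L u) \<and>
     (\<forall>r. finite {u \<in> carrier \<Gamma>. L u < r}) \<and>
     (\<forall>u\<in>carrier \<Gamma>. L (inv\<^bsub>\<Gamma>\<^esub> u) = L u) \<and>
     (\<forall>u\<in>carrier \<Gamma>. \<forall>v\<in>carrier \<Gamma>. L (u \<otimes>\<^bsub>\<Gamma>\<^esub> v) \<le> L u + L v) \<and>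
     L \<one>\<^bsub>\<Gamma>\<^esub> = 0"

definition ldist :: "('a, 'b) monoid_scheme \<Rightarrow> ('a \<Rightarrow> real) \<Rightarrow> 'a \<Rightarrow> 'a \<Rightarrow> real" where
  "ldist \<Gamma> L u v = L (inv\<^bsub>\<Gamma>\<^esub> u \<otimes>\<^bsub>\<Gamma>\<^esub> v)"

definition lball :: "('a, 'b) monoid_scheme \<Rightarrow> ('a \<Rightarrow> real) \<Rightarrow> real \<Rightarrow> 'a set" where
  "lball \<Gamma> L r = {u \<in> carrier \<Gamma>. L u < r}"

(* Shells of width 1, with a real radius: for an integer-valued L the sphere of integer radius r
   is {u. L u = r}, and the sphere of half-integer radius m is {u. L u = m + 1/2}. *)
definition lsphere :: "('a, 'b) monoid_scheme \<Rightarrow> ('a \<Rightarrow> real) \<Rightarrow> real \<Rightarrow> 'a set" where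
  "lsphere \<Gamma> L r = {u \<in> carrier \<Gamma>. r \<le> L u \<and> L u < r + 1}"

definition almost_exact_growth ::
    "('a, 'b) monoid_scheme \<Rightarrow> ('a \<Rightarrow> real) \<Rightarrow> real \<Rightarrow> nat \<Rightarrow> bool" where
  "almost_exact_growth \<Gamma> L q d \<longleftrightarrow>
     (\<exists>C\<ge>1. \<forall>r::real. r \<ge> 1 \<longrightarrow>
        inverse C * r ^ d * q powr r \<le> real (card (lsphere \<Gamma> L r)) \<and>
        real (card (lsphere \<Gamma> L r)) \<le> C * r ^ d * q powr r)"

(* The radius m is real: the relation i = j + r - 2 m makes it an integer or a half-integer.

   The factor r ^ d2 is read as 1 at r = 0, hence max 1 r: for r = m = 0 and E = F = {\<one>} the left
   side is 1, so that the value 0 of r ^ d2 (for d2 > 0), as well as Isabelle's 0 powr 0 = 0,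
   would make the condition unsatisfiable. *)
definition spherical_coarse_median ::
    "('a, 'b) monoid_scheme \<Rightarrow> ('a \<Rightarrow> real) \<Rightarrow> real \<Rightarrow> bool" where
  "spherical_coarse_median \<Gamma> L d2 \<longleftrightarrow>
     (\<exists>C0>0. \<forall>(r::nat) (m::real) (i::nat) (j::nat).
        0 \<le> m \<and> m \<le> real r \<and> real i = real j + real r - 2 * m \<longrightarrow>
        (\<forall>E F. E \<subseteq> lsphere \<Gamma> L (real j) \<and> F \<subseteq> lsphere \<Gamma> L (real i) \<and> E \<noteq> {} \<and> F \<noteq> {} \<longrightarrow>
           real (card {(x, y). x \<in> E \<and> y \<in> F \<and> ldist \<Gamma> L x y = real r})
             \<le> C0 * (max 1 (real r)) powr d2 *
                min (real (card (lsphere \<Gamma> L (real r - m))) * real (card E))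
                    (real (card (lsphere \<Gamma> L m)) * real (card F))))"

definition HL_maximal ::
    "('a, 'b) monoid_scheme \<Rightarrow> ('a \<Rightarrow> real) \<Rightarrow> real \<Rightarrow> ('a \<Rightarrow> complex) \<Rightarrow> 'a \<Rightarrow> ennreal" where
  "HL_maximal \<Gamma> L r0 f x =
     (SUP r\<in>{r0<..}. ennreal ((\<Sum>u \<in> {u \<in> carrier \<Gamma>. ldist \<Gamma> L x u < r}. cmod (f u))
                              / real (card (lball \<Gamma> L r))))"

definition superlevel ::
    "('a, 'b) monoid_scheme \<Rightarrow> ('a \<Rightarrow> real) \<Rightarrow> real \<Rightarrow> ('a \<Rightarrow> complex) \<Rightarrow> real \<Rightarrow> 'a set" where
  "superlevel \<Gamma> L r0 f t = {x \<in> carrier \<Gamma>. ennreal t \<le> HL_maximal \<Gamma> L r0 f x}"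

definition LlogL :: "('a, 'b) monoid_scheme \<Rightarrow> real \<Rightarrow> ('a \<Rightarrow> complex) set" where
  "LlogL \<Gamma> c = {f. \<forall>\<eta>>0. (\<lambda>x. cmod (f x) / \<eta> * ln (cmod (f x) / \<eta>) powr c)
                             summable_on {x \<in> carrier \<Gamma>. cmod (f x) > \<eta>}}"

definition LlogL_bound ::
    "('a, 'b) monoid_scheme \<Rightarrow> ('a \<Rightarrow> real) \<Rightarrow> real \<Rightarrow> real \<Rightarrow> real \<Rightarrow> real \<Rightarrow> bool" where
  "LlogL_bound \<Gamma> L r0 c lam K \<longleftrightarrow>
     (\<forall>f\<in>LlogL \<Gamma> c. \<forall>\<eta>>0.
        finite (superlevel \<Gamma> L r0 f (lam * \<eta>)) \<and>
        real (card (superlevel \<Gamma> L r0 f (lam * \<eta>))) \<le>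
          K * (\<Sum>\<^sub>\<infinity>x \<in> {x \<in> carrier \<Gamma>. cmod (f x) > \<eta>}.
                 cmod (f x) / \<eta> * ln (cmod (f x) / \<eta>) powr c))"

definition weak_type_1_1 :: "('a, 'b) monoid_scheme \<Rightarrow> ('a \<Rightarrow> real) \<Rightarrow> real \<Rightarrow> bool" where
  "weak_type_1_1 \<Gamma> L r0 \<longleftrightarrow>
     (\<exists>K>0. \<forall>f. (\<lambda>x. cmod (f x)) summable_on carrier \<Gamma> \<longrightarrow> (\<forall>\<eta>>0.
        finite (superlevel \<Gamma> L r0 f \<eta>) \<and>
        real (card (superlevel \<Gamma> L r0 f \<eta>)) \<le> K / \<eta> * (\<Sum>\<^sub>\<infinity>x \<in> carrier \<Gamma>. cmod (f x))))"

(* The bound with lam = 1 holds for no length function, exponent c > 0 and constant K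
   (not_LlogL_bound_1 below): the maximal function of the indicator f of a large ball reaches the
   value 1 = \<eta>, while no x has |f x| > \<eta>. The maximal inequality is therefore required for every
   lam > 1, with a constant K independent of f and \<eta>. *)
definition weak_type_LlogL ::
    "('a, 'b) monoid_scheme \<Rightarrow> ('a \<Rightarrow> real) \<Rightarrow> real \<Rightarrow> real \<Rightarrow> bool" where
  "weak_type_LlogL \<Gamma> L r0 c \<longleftrightarrow>
     (if c = 0 then weak_type_1_1 \<Gamma> L r0
      else (\<forall>lam>1. \<exists>K>0. LlogL_bound \<Gamma> L r0 c lam K))"

lemma not_LlogL_bound_1:
  assumes "group \<Gamma>" and len: "length_function \<Gamma> L"
  shows "\<not> LlogL_bound \<Gamma> L r0 c 1 K"
proof
  interpret group \<Gamma> by fact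
  assume bound: "LlogL_bound \<Gamma> L r0 c 1 K"
  define R where "R = max r0 0 + 1"
  define f :: "'a \<Rightarrow> complex" where "f = (\<lambda>u. if L u < R then 1 else 0)"
  have fin: "finite (lball \<Gamma> L R)" and L1: "L \<one>\<^bsub>\<Gamma>\<^esub> = 0"
    using len by (auto simp: length_function_def lball_def)
  have one_in: "\<one>\<^bsub>\<Gamma>\<^esub> \<in> lball \<Gamma> L R"
    using L1 by (auto simp: lball_def R_def)
  have "f \<in> LlogL \<Gamma> c"
  proof -
    have "finite {x \<in> carrier \<Gamma>. cmod (f x) > \<eta>}" if "\<eta> > 0" for \<eta>
      by (rule finite_subset[OF _ fin]) (use that in \<open>auto simp: f_def lball_def split: if_splits\<close>)
    then show ?thesis by (auto simp: LlogL_def)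
  qed
  moreover have empty: "{x \<in> carrier \<Gamma>. cmod (f x) > 1} = {}"
    by (auto simp: f_def)
  ultimately have finS: "finite (superlevel \<Gamma> L r0 f 1)"
    and le: "real (card (superlevel \<Gamma> L r0 f 1)) \<le> 0"
    using bound[unfolded LlogL_bound_def, rule_format, of f 1] by (simp_all add: empty)
  have ball: "{u \<in> carrier \<Gamma>. ldist \<Gamma> L \<one>\<^bsub>\<Gamma>\<^esub> u < R} = lball \<Gamma> L R"
    by (auto simp: ldist_def lball_def)
  have "(\<Sum>u \<in> lball \<Gamma> L R. cmod (f u)) = real (card (lball \<Gamma> L R))"
    by (simp add: f_def lball_def)
  moreover have "card (lball \<Gamma> L R) \<noteq> 0"
    using fin one_in by auto
  ultimately have "ennreal 1 = ennreal ((\<Sum>u \<in> {u \<in> carrier \<Gamma>. ldist \<Gamma> L \<one>\<^bsub>\<Gamma>\<^esub> u < R}. cmod (f u))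
      / real (card (lball \<Gamma> L R)))"
    by (simp add: ball)
  also have "\<dots> \<le> HL_maximal \<Gamma> L r0 f \<one>\<^bsub>\<Gamma>\<^esub>"
    unfolding HL_maximal_def by (rule SUP_upper) (auto simp: R_def)
  finally have "\<one>\<^bsub>\<Gamma>\<^esub> \<in> superlevel \<Gamma> L r0 f 1"
    by (simp add: superlevel_def)
  with finS le show False by auto
qed

end

theory Submission
  imports Defs
begin

text \<open>
  A ball is a disjoint union of spheres, so if all sphere averages of \<open>g\<close> at \<open>x\<close> are below \<open>1\<close>, then
  so are its ball averages. For a truncation \<open>g\<close> of \<open>f\<close> it is therefore enough to bound, for
  each integer radius \<open>r\<close>, the set \<open>H\<close> of the points at which the average of \<open>g\<close> over the sphere of
  radius \<open>r\<close> is at least \<open>1\<close>, and to sum over \<open>r\<close>.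

  A point \<open>u\<close> with \<open>g u \<ge> q ^ r\<close> is charged with all of its neighbours at distance \<open>r\<close>; the sum
  over such \<open>r\<close> is \<open>O(g u (1 + ln (g u)) ^ d)\<close>. For the remaining points, sort the pairs \<open>(x, u)\<close> at
  distance \<open>r\<close> by \<open>k = L u + r - L x \<in> {0..2 r}\<close>. The median inequality, applied with \<open>E\<close> or \<open>F\<close> a
  singleton, says that up to the factor \<open>R = r powr d2 * r ^ d\<close> each \<open>u\<close> occurs in \<open>q powr (r - k / 2)\<close>
  pairs of class \<open>k\<close>, and each \<open>x\<close> in \<open>q powr (k / 2)\<close> of them. Bounding \<open>g u\<close> by
  \<open>T k + g u * sqrt (g u / T k)\<close> with \<open>T k\<close> decreasing geometrically in \<open>k\<close>, the first terms contribute
  at most half of the mass forced by \<open>H\<close>, and the second ones give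
  \<open>card H \<le> C * r powr (2 * d2) * (\<Sum>u. g u * sqrt (g u / q ^ r))\<close>. Summed over the radii with
  \<open>q ^ r > g u\<close> this is geometric and yields \<open>O(g u (1 + ln (g u)) powr (2 * d2))\<close>.
\<close>

section \<open>Exponential sums over the radii\<close>

text \<open>The inequality \<open>1 + x \<le> exp x\<close> at \<open>x = \<kappa> * s\<close> is
  raised to the power \<open>e\<close>. The choice of \<kappa> gives
  \<open>e * \<kappa> \<le> ln z\<close>, and \<open>B\<close> pays for replacing \<open>s\<close>
  by \<open>\<kappa> * s\<close>.\<close>

lemma linear_powr_le_exponential:
  fixes z e :: real
  assumes "z > 1" "e \<ge> 0"
  obtains A where "A > 0" "\<And>s. s \<ge> 0 \<Longrightarrow> (1 + s) powr e \<le> A * z powr s"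
proof -
  define \<kappa> where "\<kappa> = ln z / (e + 1)"
  define B where "B = max 1 (1 / \<kappa>)"
  have \<kappa>: "\<kappa> > 0" using assms by (simp add: \<kappa>_def)
  have B: "B \<ge> 1" "B * \<kappa> \<ge> 1" using \<kappa> by (auto simp: B_def max_def field_simps)
  have "(1 + s) powr e \<le> B powr e * z powr s" if "s \<ge> 0" for s
  proof -
    have "1 + s \<le> B * (1 + \<kappa> * s)"
      using B(1) mult_right_mono[OF B(2) that] by (simp add: algebra_simps)
    also have "\<dots> \<le> B * exp (\<kappa> * s)"
      using B by (intro mult_left_mono) auto
    finally have "(1 + s) powr e \<le> (B * exp (\<kappa> * s)) powr e"
      using assms that by (intro powr_mono2) auto
    also have "\<dots> = B powr e * exp (e * \<kappa> * s)"
      using B by (simp add: powr_mult) (simp add: powr_def mult_ac)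
    also have "e * \<kappa> \<le> ln z"
      using assms by (simp add: \<kappa>_def field_simps)
    then have "exp (e * \<kappa> * s) \<le> z powr s"
      using assms that by (simp add: powr_def mult_right_mono mult.commute[of s])
    finally show ?thesis using B by simp
  qed
  moreover have "B powr e > 0" using B by simp
  ultimately show ?thesis using that by blast
qed

text \<open>The terms decay geometrically on both sides of the index at which \<open>z ^ r\<close>
  passes \<open>y\<close>, so two geometric series bound the sum uniformly in \<open>y\<close> and
  \<open>N\<close>.\<close>

lemma sum_two_sided_geometric_le:
  fixes z y :: real
  assumes z: "z > 1" and y: "y \<ge> 1"
  shows "(\<Sum>r<N. if z ^ r \<le> y then z ^ r / y else y / z ^ r) \<le> 2 * z / (z - 1)"
proof -
  define m where "m = (LEAST r. y < z ^ r)"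
  have ex: "\<exists>r. y < z ^ r" using real_arch_pow[OF z] .
  have m: "y < z ^ m" unfolding m_def by (rule LeastI_ex[OF ex])
  have below: "z ^ r \<le> y" if "r < m" for r
    using not_less_Least[of r "\<lambda>r. y < z ^ r"] that by (auto simp: m_def not_less)
  have "m \<noteq> 0" using m y by (cases m) auto
  then have zm: "z ^ m \<le> z * y"
    using below[of "m - 1"] z by (cases m) auto
  have above: "y < z ^ r" if "m \<le> r" for r
    using m power_increasing[OF that, of z] z by linarith
  \<comment> \<open>All terms are nonnegative, so the range may be enlarged to contain the turning
    point \<open>m\<close>, whether or not \<open>N\<close> reaches it.\<close>
  have "(\<Sum>r<N. if z ^ r \<le> y then z ^ r / y else y / z ^ r)
      \<le> (\<Sum>r<N+m. if z ^ r \<le> y then z ^ r / y else y / z ^ r)"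
    using z y by (intro sum_mono2) auto
  also have "\<dots> = (\<Sum>r<m. if z ^ r \<le> y then z ^ r / y else y / z ^ r)
      + (\<Sum>r=m..<N+m. if z ^ r \<le> y then z ^ r / y else y / z ^ r)"
    by (simp add: lessThan_atLeast0 sum.atLeastLessThan_concat)
  also have "(\<Sum>r<m. if z ^ r \<le> y then z ^ r / y else y / z ^ r) = (\<Sum>r<m. z ^ r) / y"
    using below by (auto simp: sum_divide_distrib intro!: sum.cong)
  also have "(\<Sum>r<m. z ^ r) = (z ^ m - 1) / (z - 1)"
    using z geometric_sum[of z m] by simp
  also have "(z ^ m - 1) / (z - 1) / y \<le> z / (z - 1)"
  proof -
    have "(z ^ m - 1) / (z - 1) / y \<le> z * y / (z - 1) / y"
      using zm z y by (intro divide_right_mono) auto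
    then show ?thesis using y by simp
  qed
  also have "(\<Sum>r=m..<N+m. if z ^ r \<le> y then z ^ r / y else y / z ^ r)
      \<le> (\<Sum>r=m..<N+m. (1 / z) ^ (r - m))"
  proof (intro sum_mono)
    fix r assume "r \<in> {m..<N+m}"
    then have "m \<le> r" by simp
    then show "(if z ^ r \<le> y then z ^ r / y else y / z ^ r) \<le> (1 / z) ^ (r - m)"
      using above[of r] m z y
      by (auto simp: power_diff field_simps)
  qed
  also have "\<dots> = (\<Sum>i<N. (1 / z) ^ i)"
    using sum.shift_bounds_nat_ivl[of "\<lambda>r. (1 / z) ^ (r - m)" 0 m N]
    by (simp add: lessThan_atLeast0)
  also have "\<dots> \<le> z / (z - 1)"
  proof -
    have "(\<Sum>i<N. (1 / z) ^ i) = (1 - (1 / z) ^ N) / (1 - 1 / z)"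
      using z sum_gp_strict[of "1 / z" N] by simp
    also have "\<dots> \<le> 1 / (1 - 1 / z)"
      using z by (intro divide_right_mono) auto
    also have "\<dots> = z / (z - 1)" using z by (simp add: field_simps)
    finally show ?thesis .
  qed
  finally show ?thesis by simp
qed

lemma sum_power_le:
  fixes \<beta> :: real assumes "0 \<le> \<beta>" "\<beta> < 1"
  shows "(\<Sum>k\<le>n. \<beta> ^ k) \<le> 1 / (1 - \<beta>)"
proof -
  have "(\<Sum>k\<le>n. \<beta> ^ k) = (1 - \<beta> ^ Suc n) / (1 - \<beta>)"
    using assms sum_gp0[of \<beta> n] by simp
  also have "\<dots> \<le> 1 / (1 - \<beta>)" using assms by (intro divide_right_mono) auto
  finally show ?thesis .
qed

text \<open>Turns summability hypotheses on \<open>f\<close> into finiteness of the sets on which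
  \<open>f\<close> is large.\<close>

lemma finite_if_summable_on_bounded_below:
  fixes h :: "'a \<Rightarrow> real"
  assumes h: "h summable_on A" and c: "c > 0" and le: "\<And>x. x \<in> A \<Longrightarrow> c \<le> h x"
  shows "finite A"
proof (rule ccontr)
  assume "infinite A"
  obtain n :: nat where n: "infsum h A < real n * c" using reals_Archimedean3[OF c] by blast
  obtain B where B: "finite B" "card B = n" "B \<subseteq> A"
    using infinite_arbitrarily_large[OF \<open>infinite A\<close>] by blast
  have "real n * c \<le> sum h B" using sum_bounded_below[of B c h] le B by auto
  also have "\<dots> \<le> infsum h A"
    using le c by (intro finite_sum_le_infsum h B) (auto intro: order_trans[OF less_imp_le[OF c]])
  finally show False using n by simp
qed

lemma powr_base_le_iff:
  fixes a b e :: real assumes "a > 0" "b > 0" "e > 0"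
  shows "a powr e \<le> b powr e \<longleftrightarrow> a \<le> b"
  using assms by (simp add: powr_def)

lemma power_powr_swap:
  fixes q :: real assumes "q > 0"
  shows "(q ^ r) powr e = (q powr e) ^ r"
proof -
  have "(q ^ r) powr e = (q powr real r) powr e"
    using assms by (subst powr_realpow) auto
  also have "\<dots> = (q powr e) powr real r"
    by (simp only: powr_powr mult.commute)
  also have "\<dots> = (q powr e) ^ r"
    using assms by (intro powr_realpow) auto
  finally show ?thesis .
qed

lemma powr_power_divide:
  fixes q t :: real assumes "q > 0" "t > 0"
  shows "(q ^ r / t) powr e = (q powr e) ^ r / t powr e"
  using assms by (simp add: powr_divide power_powr_swap)

text \<open>Here \<open>t\<close> is a single value \<open>g u\<close>, and
  \<open>ln t / ln q\<close> is the critical radius at which \<open>q ^ r = t\<close>. On either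
  side of it a term is at most a constant times \<open>t\<close>, a power of
  \<open>1 + ln t\<close>, and the fourth root of \<open>q ^ r / t\<close> or of its inverse; these
  roots form a two-sided geometric series.\<close>

lemma sum_radii_le:
  fixes q e C :: real and d :: nat
  assumes q: "q > 1" and e: "e \<ge> 0" and C: "C > 0"
  obtains K where "K > 0"
    "\<And>t N. t \<ge> 1 \<Longrightarrow> (\<Sum>r<N. if q ^ r \<le> t then C * max 1 (real r) ^ d * q ^ r
        else C * max 1 (real r) powr e * (t * sqrt (t / q ^ r)))
      \<le> K * (t * (1 + ln t) powr (e + real d))"
proof -
  \<comment> \<open>Fourth roots leave room: \<open>sqrt (t / q ^ r)\<close> is the square of
    \<open>y / z ^ r\<close>, so above the critical radius one factor pays for the power of
    \<open>r\<close> and the other is left for the summation.\<close>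
  define z where "z = q powr (1/4)"
  have z: "z > 1" using q by (simp add: z_def)
  obtain A0 where A0: "A0 > 0" "\<And>s. s \<ge> 0 \<Longrightarrow> (1 + s) powr e \<le> A0 * z powr s"
    using linear_powr_le_exponential[OF z e] by blast
  define A where "A = max 1 A0"
  have A: "A \<ge> 1" "\<And>s. s \<ge> 0 \<Longrightarrow> (1 + s) powr e \<le> A * z powr s"
  proof -
    show "A \<ge> 1" by (simp add: A_def)
    show "(1 + s) powr e \<le> A * z powr s" if "s \<ge> 0" for s
      using A0(2)[OF that] mult_right_mono[of A0 A "z powr s"] by (auto simp: A_def)
  qed
  define M where "M = max 1 (1 / ln q)"
  have lnq: "ln q > 0" using q by simp
  have M: "M \<ge> 1" "M * ln q \<ge> 1" using lnq by (auto simp: M_def max_def field_simps)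
  define K where "K = C * A * M powr (e + real d) * (2 * z / (z - 1))"
  have "(\<Sum>r<N. if q ^ r \<le> t then C * max 1 (real r) ^ d * q ^ r
        else C * max 1 (real r) powr e * (t * sqrt (t / q ^ r)))
      \<le> K * (t * (1 + ln t) powr (e + real d))" if t: "t \<ge> 1" for t N
  proof -
    define y where "y = t powr (1/4)"
    \<comment> \<open>By the choice of \<open>M\<close>, \<open>l\<close> is at least the critical
      radius plus 1.\<close>
    define l where "l = M * (1 + ln t)"
    have y: "y \<ge> 1" using t by (simp add: y_def ge_one_powr_ge_zero)
    have lt: "ln t \<ge> 0" using t by simp
    have l: "l \<ge> 1" using M(1) lt mult_mono[of 1 M 1 "1 + ln t"] by (simp add: l_def)
    have l_ge: "ln t / ln q \<le> l - 1" "ln t / ln q \<ge> 0"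
    proof -
      have "ln t / ln q \<le> M * ln t"
        using mult_right_mono[OF M(2) lt] lnq by (simp add: field_simps)
      then show "ln t / ln q \<le> l - 1" using M(1) by (simp add: l_def algebra_simps)
    qed (use lt lnq in auto)
    have iff: "q ^ r \<le> t \<longleftrightarrow> z ^ r \<le> y" for r
      using powr_base_le_iff[of "q ^ r" t "1/4"] q t by (simp add: z_def y_def power_powr_swap)
    have step: "(if q ^ r \<le> t then C * max 1 (real r) ^ d * q ^ r
        else C * max 1 (real r) powr e * (t * sqrt (t / q ^ r)))
       \<le> C * A * l powr (e + real d) * t * (if z ^ r \<le> y then z ^ r / y else y / z ^ r)" for r
    proof (cases "q ^ r \<le> t")
      case True
      then have "real r * ln q \<le> ln t"
        using q t ln_mono[of "q ^ r" t] by (simp add: ln_realpow)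
      then have "real r \<le> ln t / ln q" using lnq by (simp add: field_simps)
      then have "max 1 (real r) \<le> l" using l l_ge by simp
      then have "max 1 (real r) ^ d \<le> l ^ d" by (intro power_mono) auto
      also have "\<dots> = l powr real d" using l by (simp add: powr_realpow)
      also have "\<dots> \<le> l powr (e + real d)" using l e by (intro powr_mono) auto
      finally have 1: "max 1 (real r) ^ d \<le> A * l powr (e + real d)"
        using A(1) mult_right_mono[of 1 A "l powr (e + real d)"] by simp
      have "q ^ r / t \<le> (q ^ r / t) powr (1/4)"
        using True q t powr_mono'[of "1/4" 1 "q ^ r / t"] by simp
      also have "\<dots> = z ^ r / y" using powr_power_divide[of q t r "1/4"] q t by (simp add: z_def y_def)
      finally have 2: "q ^ r \<le> t * (z ^ r / y)" using t by (simp add: field_simps)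
      have "max 1 (real r) ^ d * q ^ r \<le> (A * l powr (e + real d)) * (t * (z ^ r / y))"
        using 1 2 q A(1) by (intro mult_mono) auto
      then have "C * (max 1 (real r) ^ d * q ^ r) \<le> C * ((A * l powr (e + real d)) * (t * (z ^ r / y)))"
        using C by (intro mult_left_mono) auto
      then show ?thesis using True iff[of r] by (simp add: mult_ac)
    next
      case False
      \<comment> \<open>The excess over the critical radius: \<open>q powr s = q ^ r / t\<close>,
        and \<open>r\<close> is at most \<open>l * (1 + s)\<close>, which separates the logarithm of
        \<open>t\<close> from the part that the exponential absorbs.\<close>
      define s where "s = real r - ln t / ln q"
      have "real r * ln q > ln t"
        using q t False ln_less_cancel_iff[of t "q ^ r"] by (simp add: ln_realpow)
      then have s: "s > 0" using lnq by (simp add: s_def field_simps)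
      have "q powr s = q ^ r / t"
        using q t lnq by (simp add: s_def powr_diff powr_realpow) (simp add: powr_def)
      then have zs: "z powr s = z ^ r / y"
        using powr_power_divide[of q t r "1/4"] q t
        by (simp add: z_def y_def powr_powr mult.commute[of _ s] flip: \<open>q powr s = q ^ r / t\<close>)
      have "l * s \<ge> s" using l s by simp
      then have "max 1 (real r) \<le> l * (1 + s)"
        using l_ge l s by (auto simp: s_def algebra_simps)
      then have "max 1 (real r) powr e \<le> (l * (1 + s)) powr e"
        using e by (intro powr_mono2) auto
      also have "\<dots> = l powr e * (1 + s) powr e" using l s by (simp add: powr_mult)
      also have "\<dots> \<le> l powr (e + real d) * (A * z powr s)"
        using l s A(2)[of s] by (intro mult_mono powr_mono) auto
      finally have 1: "max 1 (real r) powr e \<le> A * l powr (e + real d) * (z ^ r / y)"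
        by (simp add: zs mult_ac)
      have "sqrt (t / q ^ r) = (q ^ r / t) powr (- 1/2)"
        using q t by (simp add: powr_half_sqrt[symmetric] powr_minus_divide powr_divide)
      also have "\<dots> = ((q ^ r / t) powr (1/4)) powr (-2)" by (simp add: powr_powr)
      also have "\<dots> = (z ^ r / y) powr (-2)"
        using powr_power_divide[of q t r "1/4"] q t by (simp add: z_def y_def)
      also have "\<dots> = (y / z ^ r)\<^sup>2"
        using z y by (simp add: powr_minus_divide powr_numeral power_divide)
      finally have 2: "sqrt (t / q ^ r) = (y / z ^ r)\<^sup>2" .
      have "max 1 (real r) powr e * (t * sqrt (t / q ^ r))
          \<le> (A * l powr (e + real d) * (z ^ r / y)) * (t * (y / z ^ r)\<^sup>2)"
        unfolding 2 using t by (intro mult_right_mono 1) auto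
      also have "\<dots> = A * l powr (e + real d) * t * (y / z ^ r)"
        using y z by (simp add: field_simps power2_eq_square)
      finally have "C * (max 1 (real r) powr e * (t * sqrt (t / q ^ r)))
          \<le> C * (A * l powr (e + real d) * t * (y / z ^ r))"
        using C by (intro mult_left_mono) auto
      then show ?thesis using False iff[of r] by (simp add: mult_ac)
    qed
    have "(\<Sum>r<N. if q ^ r \<le> t then C * max 1 (real r) ^ d * q ^ r
        else C * max 1 (real r) powr e * (t * sqrt (t / q ^ r)))
      \<le> C * A * l powr (e + real d) * t * (\<Sum>r<N. if z ^ r \<le> y then z ^ r / y else y / z ^ r)"
      unfolding sum_distrib_left by (intro sum_mono step)
    also have "\<dots> \<le> C * A * l powr (e + real d) * t * (2 * z / (z - 1))"
      using C A(1) t by (intro mult_left_mono sum_two_sided_geometric_le z y) auto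
    also have "\<dots> = K * (t * (1 + ln t) powr (e + real d))"
      using M(1) lt by (simp add: K_def l_def powr_mult mult_ac)
    finally show ?thesis .
  qed
  moreover have "K > 0" using C A(1) M(1) z by (simp add: K_def)
  ultimately show ?thesis using that by blast
qed

section \<open>Integer-valued length functions and ball averages\<close>

locale length_group = group \<Gamma> for \<Gamma> :: "('a, 'b) monoid_scheme" (structure) +
  fixes L :: "'a \<Rightarrow> real"
  assumes length: "length_function \<Gamma> L"
    and integral: "u \<in> carrier \<Gamma> \<Longrightarrow> L u \<in> \<int>"
begin

abbreviation dist_eq :: "'a \<Rightarrow> nat \<Rightarrow> 'a set" where
  "dist_eq x r \<equiv> {u \<in> carrier \<Gamma>. ldist \<Gamma> L x u = real r}"

lemma L_nonneg: "u \<in> carrier \<Gamma> \<Longrightarrow> 0 \<le> L u"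
  and L_inv: "u \<in> carrier \<Gamma> \<Longrightarrow> L (inv u) = L u"
  and L_mult: "u \<in> carrier \<Gamma> \<Longrightarrow> v \<in> carrier \<Gamma> \<Longrightarrow> L (u \<otimes> v) \<le> L u + L v"
  and L_one: "L \<one> = 0"
  and finite_L_less: "finite {u \<in> carrier \<Gamma>. L u < s}"
  using length by (auto simp: length_function_def)

lemma L_nat:
  assumes "u \<in> carrier \<Gamma>" obtains n where "L u = real n"
  using integral[OF assms] L_nonneg[OF assms] by (metis Ints_cases of_int_0_le_iff nonneg_int_cases of_int_of_nat_eq)

lemma lsphere_of_nat: "lsphere \<Gamma> L (real n) = {u \<in> carrier \<Gamma>. L u = real n}"
proof -
  have "L u = real n" if "u \<in> carrier \<Gamma>" "real n \<le> L u" "L u < real n + 1" for u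
    using that by (elim L_nat) auto
  then show ?thesis by (auto simp: lsphere_def)
qed

lemma finite_lsphere: "finite (lsphere \<Gamma> L s)"
  by (rule finite_subset[OF _ finite_L_less[of "s + 1"]]) (auto simp: lsphere_def)

lemma ldist_commute:
  assumes "x \<in> carrier \<Gamma>" "y \<in> carrier \<Gamma>"
  shows "ldist \<Gamma> L x y = ldist \<Gamma> L y x"
proof -
  have "inv (inv x \<otimes> y) = inv y \<otimes> x" using assms by (simp add: inv_mult_group)
  then show ?thesis using L_inv[of "inv x \<otimes> y"] assms by (simp add: ldist_def)
qed

lemma L_triangle:
  assumes "x \<in> carrier \<Gamma>" "y \<in> carrier \<Gamma>"
  shows "L y \<le> L x + ldist \<Gamma> L x y"
  using L_mult[of x "inv x \<otimes> y"] assms by (simp add: ldist_def m_assoc[symmetric])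

lemma ldist_nat:
  assumes "x \<in> carrier \<Gamma>" "y \<in> carrier \<Gamma>" obtains n where "ldist \<Gamma> L x y = real n"
  using L_nat[of "inv x \<otimes> y"] assms by (auto simp: ldist_def)

text \<open>Left invariance of the distance: counts around \<open>x\<close> reduce to counts around
  the identity.\<close>

lemma bij_betw_translate:
  assumes x: "x \<in> carrier \<Gamma>"
  shows "bij_betw ((\<otimes>) x) {v \<in> carrier \<Gamma>. P (L v)} {u \<in> carrier \<Gamma>. P (ldist \<Gamma> L x u)}"
  by (rule bij_betw_byWitness[where f' = "\<lambda>u. inv x \<otimes> u"])
     (use x in \<open>auto simp: ldist_def m_assoc[symmetric]\<close>)

lemma card_dist_eq: "x \<in> carrier \<Gamma> \<Longrightarrow> card (dist_eq x r) = card (lsphere \<Gamma> L (real r))"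
  using bij_betw_same_card[OF bij_betw_translate[of x "\<lambda>s. s = real r"]] by (simp add: lsphere_of_nat)

lemma finite_dist_eq: "x \<in> carrier \<Gamma> \<Longrightarrow> finite (dist_eq x r)"
  using bij_betw_finite[OF bij_betw_translate[of x "\<lambda>s. s = real r"]] finite_lsphere[of "real r"]
  by (simp add: lsphere_of_nat)

text \<open>By integrality a ball of radius \<open>s\<close> is the disjoint union of the spheres
  with integer radius below \<open>s\<close>, both around \<open>x\<close> and around the identity,
  and the hypotheses for these radii are added.\<close>

lemma ball_sum_le:
  assumes x: "x \<in> carrier \<Gamma>" and s: "s > 0" and g: "finite G" "G \<subseteq> carrier \<Gamma>"
    and less: "\<And>n. (\<Sum>u \<in> {u \<in> G. ldist \<Gamma> L x u = real n}. g u) < real (card (lsphere \<Gamma> L (real n)))"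
  shows "(\<Sum>u \<in> {u \<in> G. ldist \<Gamma> L x u < s}. g u) \<le> real (card (lball \<Gamma> L s))"
proof -
  define N where "N = nat \<lceil>s\<rceil>"
  have N: "real n < s \<longleftrightarrow> n < N" for n by (simp add: N_def) linarith
  have "{u \<in> G. ldist \<Gamma> L x u < s} = (\<Union>n<N. {u \<in> G. ldist \<Gamma> L x u = real n})"
    using g(2) x by (auto simp: N[symmetric] elim: ldist_nat)
  then have "(\<Sum>u \<in> {u \<in> G. ldist \<Gamma> L x u < s}. g u)
      = (\<Sum>n<N. \<Sum>u \<in> {u \<in> G. ldist \<Gamma> L x u = real n}. g u)"
    using g(1) by (simp only:) (subst sum.UNION_disjoint; auto)
  also have "\<dots> \<le> (\<Sum>n<N. real (card (lsphere \<Gamma> L (real n))))"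
    using less by (intro sum_mono less_imp_le)
  also have "\<dots> = real (card (\<Union>n<N. lsphere \<Gamma> L (real n)))"
    by (subst card_UN_disjoint) (simp_all add: finite_lsphere, auto simp: lsphere_of_nat)
  also have "(\<Union>n<N. lsphere \<Gamma> L (real n)) = lball \<Gamma> L s"
    by (auto simp: lsphere_of_nat lball_def N[symmetric]) (metis N L_nat lessThan_iff)
  finally show ?thesis .
qed

lemma finite_lball: "finite (lball \<Gamma> L s)"
  unfolding lball_def by (rule finite_L_less)

lemma card_lball_pos: "s > 0 \<Longrightarrow> card (lball \<Gamma> L s) > 0"
  using finite_lball[of s] L_one by (auto simp: card_gt_0_iff lball_def)

lemma card_ldist_less:
  assumes x: "x \<in> carrier \<Gamma>"
  shows "card {u \<in> carrier \<Gamma>. ldist \<Gamma> L x u < s} = card (lball \<Gamma> L s)"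
    and "finite {u \<in> carrier \<Gamma>. ldist \<Gamma> L x u < s}"
  using bij_betw_same_card[OF bij_betw_translate[OF x, of "\<lambda>t. t < s"]]
    bij_betw_finite[OF bij_betw_translate[OF x, of "\<lambda>t. t < s"]] finite_lball[of s]
  by (simp_all add: lball_def)

text \<open>Pointwise, \<open>cmod (f u)\<close> is at most \<open>a\<close> plus the part of it
  living on \<open>G\<close>. The constant contributes \<open>a\<close> to every ball average; the
  other part, measured in units of \<delta>, has small sphere averages and contributes at most
  \<delta>.\<close>

lemma HL_maximal_le:
  assumes x: "x \<in> carrier \<Gamma>" and r0: "r0 > 0" and \<delta>: "\<delta> > 0" and a: "a \<ge> 0"
    and G: "G = {u \<in> carrier \<Gamma>. a < cmod (f u)}" and fin: "finite G"
    and less: "\<And>n. (\<Sum>u \<in> {u \<in> G. ldist \<Gamma> L x u = real n}. cmod (f u) / \<delta>)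
                  < real (card (lsphere \<Gamma> L (real n)))"
  shows "HL_maximal \<Gamma> L r0 f x \<le> ennreal (a + \<delta>)"
  unfolding HL_maximal_def
proof (rule SUP_least, rule ennreal_leI)
  fix s assume "s \<in> {r0<..}"
  then have s: "s > 0" using r0 by simp
  let ?B = "{u \<in> carrier \<Gamma>. ldist \<Gamma> L x u < s}"
  have GB: "{u \<in> G. ldist \<Gamma> L x u < s} = {u \<in> ?B. a < cmod (f u)}" by (auto simp: G)
  have "(\<Sum>u\<in>?B. cmod (f u)) \<le> (\<Sum>u\<in>?B. a + (if a < cmod (f u) then cmod (f u) else 0))"
    using a by (intro sum_mono) auto
  also have "\<dots> = real (card ?B) * a + \<delta> * (\<Sum>u \<in> {u \<in> G. ldist \<Gamma> L x u < s}. cmod (f u) / \<delta>)"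
    using \<delta> card_ldist_less(2)[OF x]
    by (simp add: GB sum.distrib sum.inter_filter[symmetric] sum_divide_distrib[symmetric])
  also have "\<dots> \<le> real (card (lball \<Gamma> L s)) * a + \<delta> * real (card (lball \<Gamma> L s))"
    using \<delta> ball_sum_le[OF x s fin _ less] card_ldist_less(1)[OF x]
    by (intro add_mono mult_left_mono) (auto simp: G)
  finally show "(\<Sum>u\<in>?B. cmod (f u)) / real (card (lball \<Gamma> L s)) \<le> a + \<delta>"
    using card_lball_pos[OF s] by (simp add: field_simps)
qed

end

section \<open>Sphere growth and the median inequality\<close>

locale median_growth_group = length_group \<Gamma> L for \<Gamma> :: "('a, 'b) monoid_scheme" (structure) and L +
  fixes q d2 :: real and d :: nat
  assumes q: "q > 1" and d2: "d2 \<ge> 0"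
    and growth: "almost_exact_growth \<Gamma> L q d"
    and median: "spherical_coarse_median \<Gamma> L d2"
begin

text \<open>Growth is assumed from radius 1 on, but the median inequality also brings in the radii 0
  and 1/2. Shells of radius below 1 lie in the finite set where \<open>L u < 2\<close>, whose
  cardinality is added to the constant.\<close>

lemma card_lsphere_le:
  obtains C where "C > 0"
    "\<And>s. s \<ge> 0 \<Longrightarrow> real (card (lsphere \<Gamma> L s)) \<le> C * max 1 s ^ d * q powr s"
proof -
  obtain C where C: "C \<ge> 1"
    "\<And>s. s \<ge> 1 \<Longrightarrow> real (card (lsphere \<Gamma> L s)) \<le> C * s ^ d * q powr s"
    using growth unfolding almost_exact_growth_def by blast
  define M where "M = real (card {u \<in> carrier \<Gamma>. L u < 2})"
  have "real (card (lsphere \<Gamma> L s)) \<le> (C + M) * max 1 s ^ d * q powr s" if s: "s \<ge> 0" for s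
  proof (cases "s \<ge> 1")
    case True
    have "C * (s ^ d * q powr s) \<le> (C + M) * (s ^ d * q powr s)"
      using True q by (intro mult_right_mono) (auto simp: M_def)
    then have "C * (s ^ d * q powr s) \<le> (C + M) * max 1 s ^ d * q powr s"
      using True by (simp only: max_absorb2 mult.assoc)
    then show ?thesis using C(2)[OF True] by (simp only: mult.assoc)
  next
    case False
    have "real (card (lsphere \<Gamma> L s)) \<le> M"
      unfolding M_def of_nat_le_iff using False
      by (intro card_mono finite_L_less) (auto simp: lsphere_def)
    also have "\<dots> \<le> (C + M) * 1" using C(1) by simp
    also have "\<dots> \<le> (C + M) * q powr s"
      using C(1) q s by (intro mult_left_mono) (auto simp: M_def ge_one_powr_ge_zero)
    finally show ?thesis using False by (simp add: max_def)
  qed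
  moreover have "C + M > 0" using C(1) by (simp add: M_def)
  ultimately show ?thesis using that by blast
qed

text \<open>At radius 0 the left side is 1 thanks to \<open>max 1\<close>, and the sphere contains
  the identity.\<close>

lemma card_lsphere_ge:
  obtains C where "C > 0"
    "\<And>n. max 1 (real n) ^ d * q ^ n \<le> C * real (card (lsphere \<Gamma> L (real n)))"
proof -
  obtain C where C: "C \<ge> 1"
    "\<And>s. s \<ge> 1 \<Longrightarrow> inverse C * s ^ d * q powr s \<le> real (card (lsphere \<Gamma> L s))"
    using growth unfolding almost_exact_growth_def by blast
  have "max 1 (real n) ^ d * q ^ n \<le> C * real (card (lsphere \<Gamma> L (real n)))" for n
  proof (cases "n = 0")
    case True
    have "card (lsphere \<Gamma> L 0) > 0"
      using finite_lsphere[of 0] L_one by (auto simp: card_gt_0_iff lsphere_def intro!: exI[of _ \<one>])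
    then have "real (card (lsphere \<Gamma> L 0)) \<ge> 1" by simp
    then show ?thesis using True C(1) mult_mono[of 1 C 1 "real (card (lsphere \<Gamma> L 0))"] by simp
  next
    case False
    then have n: "real n \<ge> 1" by simp
    have "max 1 (real n) ^ d * q ^ n = C * (inverse C * real n ^ d * q powr real n)"
      using C(1) q n by (simp add: max_absorb2 powr_realpow)
    also have "\<dots> \<le> C * real (card (lsphere \<Gamma> L (real n)))"
      using C(1) C(2)[OF n] by (intro mult_left_mono) auto
    finally show ?thesis .
  qed
  moreover have "C > 0" using C(1) by simp
  ultimately show ?thesis using that by blast
qed

text \<open>All points counted lie in one sphere, of radius \<open>L u + r - k\<close>. So the
  median inequality applies with \<open>E = {u}\<close>, \<open>F\<close> the whole fibre and
  \<open>m = k / 2\<close>, and the first entry of its minimum is the cardinality of the sphere of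
  radius \<open>r - k / 2\<close>.\<close>

lemma card_fibre_le:
  obtains C where "C > 0"
    "\<And>r u k. u \<in> carrier \<Gamma> \<Longrightarrow> k \<le> 2 * r \<Longrightarrow>
       real (card {x \<in> carrier \<Gamma>. ldist \<Gamma> L u x = real r \<and> L x + real k = L u + real r})
         \<le> C * max 1 (real r) powr d2 * max 1 (real r) ^ d * q powr (real r - real k / 2)"
proof -
  obtain C1 where C1: "C1 > 0"
    "\<And>s. s \<ge> 0 \<Longrightarrow> real (card (lsphere \<Gamma> L s)) \<le> C1 * max 1 s ^ d * q powr s"
    using card_lsphere_le by blast
  obtain C0 where C0: "C0 > 0"
    and med0: "\<forall>(r::nat) (m::real) (i::nat) (j::nat).
        0 \<le> m \<and> m \<le> real r \<and> real i = real j + real r - 2 * m \<longrightarrow>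
        (\<forall>E F. E \<subseteq> lsphere \<Gamma> L (real j) \<and> F \<subseteq> lsphere \<Gamma> L (real i) \<and> E \<noteq> {} \<and> F \<noteq> {} \<longrightarrow>
           real (card {(x, y). x \<in> E \<and> y \<in> F \<and> ldist \<Gamma> L x y = real r})
             \<le> C0 * (max 1 (real r)) powr d2 *
                min (real (card (lsphere \<Gamma> L (real r - m))) * real (card E))
                    (real (card (lsphere \<Gamma> L m)) * real (card F)))"
    using median unfolding spherical_coarse_median_def by (elim exE conjE)
  have med: "\<And>(r::nat) (m::real) (i::nat) (j::nat) E F.
      \<lbrakk>0 \<le> m; m \<le> real r; real i = real j + real r - 2 * m; E \<subseteq> lsphere \<Gamma> L (real j);
       F \<subseteq> lsphere \<Gamma> L (real i); E \<noteq> {}; F \<noteq> {}\<rbrakk> \<Longrightarrow>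
      real (card {(x, y). x \<in> E \<and> y \<in> F \<and> ldist \<Gamma> L x y = real r})
             \<le> C0 * (max 1 (real r)) powr d2 *
                min (real (card (lsphere \<Gamma> L (real r - m))) * real (card E))
                    (real (card (lsphere \<Gamma> L m)) * real (card F))"
    by (intro med0[rule_format] conjI)
  have "real (card {x \<in> carrier \<Gamma>. ldist \<Gamma> L u x = real r \<and> L x + real k = L u + real r})
         \<le> C0 * C1 * max 1 (real r) powr d2 * max 1 (real r) ^ d * q powr (real r - real k / 2)"
    (is "real (card ?X) \<le> ?rhs") if u: "u \<in> carrier \<Gamma>" and k: "k \<le> 2 * r" for r u k
  proof (cases "?X = {}")
    case True
    then show ?thesis using C0 C1(1) by (simp only: card.empty) simp
  next
    case False
    then obtain x where x: "x \<in> ?X" by blast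
    obtain i where i: "L x = real i" using x L_nat by blast
    obtain j where j: "L u = real j" using u L_nat by blast
    have ij: "real i = real j + real r - 2 * (real k / 2)" using x i j by simp
    have X: "?X \<subseteq> lsphere \<Gamma> L (real i)" using i j x by (auto simp: lsphere_of_nat)
    have u': "{u} \<subseteq> lsphere \<Gamma> L (real j)" using u j by (simp add: lsphere_of_nat)
    have "{(x, y). x \<in> {u} \<and> y \<in> ?X \<and> ldist \<Gamma> L x y = real r} = Pair u ` ?X" by auto
    then have "real (card ?X) = real (card {(x, y). x \<in> {u} \<and> y \<in> ?X \<and> ldist \<Gamma> L x y = real r})"
      by (simp add: card_image inj_on_def)
    also have "\<dots> \<le> C0 * (max 1 (real r)) powr d2 *
                min (real (card (lsphere \<Gamma> L (real r - real k / 2))) * real (card {u}))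
                    (real (card (lsphere \<Gamma> L (real k / 2))) * real (card ?X))"
      using k by (intro med[OF _ _ ij u' X _ False]) auto
    also have "\<dots> \<le> C0 * (max 1 (real r)) powr d2 * (C1 * max 1 (real r) ^ d * q powr (real r - real k / 2))"
    proof (rule mult_left_mono)
      have "real (card (lsphere \<Gamma> L (real r - real k / 2)))
          \<le> C1 * max 1 (real r - real k / 2) ^ d * q powr (real r - real k / 2)"
        using k by (intro C1(2)) simp
      also have "\<dots> \<le> C1 * max 1 (real r) ^ d * q powr (real r - real k / 2)"
        using C1(1) by (intro mult_right_mono mult_left_mono power_mono) auto
      finally show "min (real (card (lsphere \<Gamma> L (real r - real k / 2))) * real (card {u}))
          (real (card (lsphere \<Gamma> L (real k / 2))) * real (card ?X))
          \<le> C1 * max 1 (real r) ^ d * q powr (real r - real k / 2)" by simp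
    qed (use C0 in simp)
    finally show ?thesis by (simp add: mult_ac)
  qed
  moreover have "C0 * C1 > 0" using C0 C1(1) by simp
  ultimately show ?thesis using that by blast
qed

text \<open>The triangle inequality, used in both directions, bounds \<open>L x - L u\<close> by
  \<open>r\<close> in absolute value; hence the classes \<open>k \<le> 2 * r\<close> exhaust the
  pairs at distance \<open>r\<close>.\<close>

lemma ex_level_difference:
  assumes "x \<in> carrier \<Gamma>" "u \<in> carrier \<Gamma>" "ldist \<Gamma> L u x = real r"
  obtains k where "k \<le> 2 * r" "L x + real k = L u + real r"
proof -
  obtain i j where "L x = real i" "L u = real j" using assms L_nat by metis
  moreover have "L x \<le> L u + real r" "L u \<le> L x + real r"
    using assms L_triangle[of u x] L_triangle[of x u] ldist_commute[of x u] by auto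
  ultimately show ?thesis using that[of "j + r - i"] by (simp add: of_nat_diff)
qed

section \<open>Counting the points with large sphere averages\<close>

text \<open>The set \<open>H\<close> of the overview, with the average multiplied out. The support
  \<open>G\<close> is kept apart from \<open>g\<close>, so that points can be discarded without
  changing the function.\<close>

definition heavy :: "'a set \<Rightarrow> ('a \<Rightarrow> real) \<Rightarrow> nat \<Rightarrow> 'a set" where
  "heavy G g r = {x \<in> carrier \<Gamma>.
     real (card (lsphere \<Gamma> L (real r))) \<le> (\<Sum>u \<in> {u \<in> G. ldist \<Gamma> L x u = real r}. g u)}"

lemma card_lsphere_pos: "card (lsphere \<Gamma> L (real r)) > 0"
proof -
  obtain C where "C > 0"
    "\<And>n. max 1 (real n) ^ d * q ^ n \<le> C * real (card (lsphere \<Gamma> L (real n)))"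
    using card_lsphere_ge by blast
  moreover have "max 1 (real r) ^ d * q ^ r > 0" using q by simp
  ultimately have "C * real (card (lsphere \<Gamma> L (real r))) > 0" by (meson less_le_trans)
  then show ?thesis using \<open>C > 0\<close> by (simp add: zero_less_mult_iff)
qed

text \<open>A sphere that misses \<open>G\<close> has sum 0, whereas sphere cardinalities are
  positive. The inclusion serves to make the heavy sets finite.\<close>

lemma heavy_subset: "heavy G g r \<subseteq> (\<Union>u\<in>G. dist_eq u r)" if "G \<subseteq> carrier \<Gamma>"
proof
  fix x assume x: "x \<in> heavy G g r"
  have "{u \<in> G. ldist \<Gamma> L x u = real r} \<noteq> {}"
  proof
    assume "{u \<in> G. ldist \<Gamma> L x u = real r} = {}"
    then have "(\<Sum>u \<in> {u \<in> G. ldist \<Gamma> L x u = real r}. g u) = 0" by (simp only: sum.empty)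
    then show False using x card_lsphere_pos[of r] by (simp add: heavy_def)
  qed
  then obtain u where u: "u \<in> G" "ldist \<Gamma> L x u = real r" by blast
  then show "x \<in> (\<Union>u\<in>G. dist_eq u r)"
    using x that ldist_commute[of x u] by (auto simp: heavy_def intro!: bexI[of _ u])
qed

lemma finite_heavy: "finite (heavy G g r)" if "finite G" "G \<subseteq> carrier \<Gamma>"
  using that finite_dist_eq by (intro finite_subset[OF heavy_subset]) auto

text \<open>Double counting: every heavy point forces mass of order \<open>r ^ d * q ^ r\<close> on
  its sphere. In class \<open>k\<close> the value \<open>g u\<close> is replaced by
  \<open>T k + h k u\<close>, and the \<open>T k\<close> part is absorbed by the forced mass. The
  factor \<open>r ^ d\<close> of the fibre bounds cancels against that of the forced mass, so the
  result does not contain \<open>d\<close>.\<close>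

lemma card_heavy_le:
  obtains C where "C > 0"
    "\<And>r G g. finite G \<Longrightarrow> G \<subseteq> carrier \<Gamma> \<Longrightarrow> (\<And>u. u \<in> G \<Longrightarrow> g u > 0) \<Longrightarrow>
       real (card (heavy G g r)) \<le> C * max 1 (real r) powr (2 * d2) * (\<Sum>u\<in>G. g u * sqrt (g u / q ^ r))"
proof -
  obtain Cl where Cl: "Cl > 0"
    "\<And>n. max 1 (real n) ^ d * q ^ n \<le> Cl * real (card (lsphere \<Gamma> L (real n)))"
    using card_lsphere_ge by blast
  obtain Cf where Cf: "Cf > 0" and fibre: "\<And>r u k. u \<in> carrier \<Gamma> \<Longrightarrow> k \<le> 2 * r \<Longrightarrow>
       real (card {x \<in> carrier \<Gamma>. ldist \<Gamma> L u x = real r \<and> L x + real k = L u + real r})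
         \<le> Cf * max 1 (real r) powr d2 * max 1 (real r) ^ d * q powr (real r - real k / 2)"
    using card_fibre_le by blast
  \<comment> \<open>The eighth root makes all exponents below integers: up to common factors the
    fibre bounds are \<open>q ^ r * \<beta> ^ (4 * k)\<close> and
    \<open>1 / \<beta> ^ (4 * k)\<close>.\<close>
  define \<beta> where "\<beta> = q powr (-1/8)"
  have \<beta>: "0 < \<beta>" "\<beta> < 1" using q powr_less_cancel_iff[of q "-1/8" 0] by (auto simp: \<beta>_def)
  have \<beta>_pow: "\<beta> ^ (4 * k) = q powr (- real k / 2)" for k
  proof -
    have "\<beta> ^ (4 * k) = \<beta> powr real (4 * k)" using \<beta>(1) by (rule powr_realpow[symmetric])
    then show ?thesis by (simp add: \<beta>_def powr_powr)
  qed
  have q_half: "q powr (real r - real k / 2) = q ^ r * \<beta> ^ (4 * k)" for r k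
    using q by (simp add: \<beta>_pow powr_realpow[symmetric] powr_add[symmetric])
  \<comment> \<open>Solved from the requirement that the absorbed part be one half, see
    \<open>half\<close>.\<close>
  define c where "c = (1 - \<beta>\<^sup>2) / (2 * Cl * Cf)"
  have \<beta>2: "\<beta>\<^sup>2 < 1" using \<beta> by (simp add: power_less_one_iff abs_square_less_1)
  have c: "c > 0" using \<beta>2 Cl(1) Cf by (simp add: c_def)
  define C where "C = 2 * Cl * Cf / sqrt c * (1 / (1 - \<beta>))"
  have C: "C > 0" using Cl(1) Cf c \<beta> by (simp add: C_def)
  have "real (card (heavy G g r)) \<le> C * max 1 (real r) powr (2 * d2) * (\<Sum>u\<in>G. g u * sqrt (g u / q ^ r))"
    if G: "finite G" "G \<subseteq> carrier \<Gamma>" and g: "\<And>u. u \<in> G \<Longrightarrow> g u > 0" for r G g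
  proof -
    define F where "F = heavy G g r"
    define W where "W = max 1 (real r) powr d2"
    define D where "D = max 1 (real r) ^ d"
    \<comment> \<open>The exponent \<open>6 * k\<close> lies strictly between \<open>4 * k\<close>
      and \<open>8 * k\<close>, so both parts converge: \<open>T k\<close> against
      \<open>1 / \<beta> ^ (4 * k)\<close> leaves \<open>\<beta> ^ (2 * k)\<close>, and
      \<open>1 / sqrt (T k)\<close> against \<open>\<beta> ^ (4 * k)\<close> leaves
      \<open>\<beta> ^ k\<close>. Dividing by \<open>W\<close> removes the median factor from the
      part to be absorbed.\<close>
    define T where "T k = c * q ^ r * \<beta> ^ (6 * k) / W" for k
    define h where "h k u = g u * sqrt (g u / T k)" for k u
    define P where "P k x u \<longleftrightarrow> ldist \<Gamma> L u x = real r \<and> L x + real k = L u + real r" for k x u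
    define S where "S = (\<Sum>u\<in>G. g u * sqrt (g u / q ^ r))"
    have F: "finite F" "F \<subseteq> carrier \<Gamma>"
      using finite_heavy[OF G] by (auto simp: F_def heavy_def)
    have W: "W \<ge> 1" using d2 by (simp add: W_def ge_one_powr_ge_zero)
    have D: "D \<ge> 1" by (simp add: D_def)
    have qr: "q ^ r > 0" using q by simp
    have T: "T k > 0" for k using c qr W \<beta> by (simp add: T_def)
    have S: "S \<ge> 0" using g qr unfolding S_def by (intro sum_nonneg mult_nonneg_nonneg) (auto simp: less_imp_le)
    have g_le: "g u \<le> T k + h k u" if "u \<in> G" for u k
    proof (cases "g u \<le> T k")
      case True
      moreover have "0 \<le> g u * sqrt (g u / T k)" using g[OF that] T[of k] by simp
      ultimately show ?thesis by (simp add: h_def)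
    next
      case False
      then have "sqrt (g u / T k) \<ge> 1" using T[of k] by simp
      then have "g u * 1 \<le> g u * sqrt (g u / T k)"
        using g[OF that] by (intro mult_left_mono) auto
      then show ?thesis using T[of k] by (simp only: h_def)
    qed
    have h_nonneg: "0 \<le> h k u" if "u \<in> G" for k u
      using g[OF that] T[of k] by (simp add: h_def)
    \<comment> \<open>Seen from \<open>x\<close>, class \<open>k\<close> is the fibre of class
      \<open>2 * r - k\<close>, so the same fibre bound applies with the roles of the points
      exchanged.\<close>
    have fibre_x: "real (card {u \<in> G. P k x u}) \<le> Cf * W * D / \<beta> ^ (4 * k)"
      if "x \<in> F" "k \<le> 2 * r" for x k
    proof -
      have x: "x \<in> carrier \<Gamma>" using that F by blast
      have "{u \<in> G. P k x u} \<subseteq> {u \<in> carrier \<Gamma>. ldist \<Gamma> L x u = real r \<and> L u + real (2 * r - k) = L x + real r}"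
        using G x that ldist_commute[OF x] by (auto simp: P_def of_nat_diff)
      then have "real (card {u \<in> G. P k x u})
          \<le> real (card {u \<in> carrier \<Gamma>. ldist \<Gamma> L x u = real r \<and> L u + real (2 * r - k) = L x + real r})"
        by (intro of_nat_mono card_mono) (auto intro: finite_subset[OF _ finite_dist_eq[OF x, of r]])
      also have "\<dots> \<le> Cf * W * D * q powr (real r - real (2 * r - k) / 2)"
        using fibre[OF x, of "2 * r - k" r] by (simp add: W_def D_def)
      also have "real r - real (2 * r - k) / 2 = real k / 2" using that by (simp add: of_nat_diff field_simps)
      also have "q powr (real k / 2) = 1 / \<beta> ^ (4 * k)"
        unfolding \<beta>_pow by (simp add: powr_minus_divide)
      finally show ?thesis by simp
    qed
    have fibre_u: "real (card {x \<in> F. P k x u}) \<le> Cf * W * D * (q ^ r * \<beta> ^ (4 * k))"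
      if "u \<in> G" "k \<le> 2 * r" for u k
    proof -
      have u: "u \<in> carrier \<Gamma>" using that G by blast
      have "real (card {x \<in> F. P k x u})
          \<le> real (card {x \<in> carrier \<Gamma>. ldist \<Gamma> L u x = real r \<and> L x + real k = L u + real r})"
        using F by (intro of_nat_mono card_mono)
          (auto simp: P_def intro: finite_subset[OF _ finite_dist_eq[OF u, of r]])
      then show ?thesis using fibre[OF u that(2)] by (simp add: W_def D_def q_half)
    qed
    \<comment> \<open>The orders of summation differ on purpose: \<open>T k\<close> does not depend
      on \<open>u\<close>, so \<open>x\<close> is fixed and its partners are counted;
      \<open>h k u\<close> does not depend on \<open>x\<close>, so \<open>u\<close> is
      fixed.\<close>
    let ?low = "\<Sum>k\<le>2*r. \<Sum>x\<in>F. \<Sum>u\<in>G. if P k x u then T k else 0"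
    let ?high = "\<Sum>k\<le>2*r. \<Sum>u\<in>G. \<Sum>x\<in>F. if P k x u then h k u else 0"
    have "D * q ^ r * real (card F) \<le> (\<Sum>x\<in>F. Cl * real (card (lsphere \<Gamma> L (real r))))"
      using mult_right_mono[OF Cl(2)[of r], of "real (card F)"] by (simp add: D_def mult_ac)
    also have "\<dots> \<le> Cl * (\<Sum>x\<in>F. \<Sum>u \<in> {u \<in> G. ldist \<Gamma> L x u = real r}. g u)"
      using Cl(1) by (subst sum_distrib_left) (intro sum_mono mult_left_mono; simp add: F_def heavy_def)
    finally have total: "D * q ^ r * real (card F)
        \<le> Cl * (\<Sum>x\<in>F. \<Sum>u \<in> {u \<in> G. ldist \<Gamma> L x u = real r}. g u)" .
    have "(\<Sum>x\<in>F. \<Sum>u \<in> {u \<in> G. ldist \<Gamma> L x u = real r}. g u)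
        \<le> (\<Sum>x\<in>F. \<Sum>u\<in>G. \<Sum>k\<le>2*r. (if P k x u then T k else 0) + (if P k x u then h k u else 0))"
      unfolding sum.inter_filter[OF G(1)]
    proof (intro sum_mono)
      fix x u assume x: "x \<in> F" and u: "u \<in> G"
      let ?t = "\<lambda>k. (if P k x u then T k else 0) + (if P k x u then h k u else 0)"
      have nonneg: "0 \<le> ?t k" for k using T[of k] h_nonneg[OF u, of k] by simp
      show "(if ldist \<Gamma> L x u = real r then g u else 0) \<le> (\<Sum>k\<le>2*r. ?t k)"
      proof (cases "ldist \<Gamma> L x u = real r")
        case True
        have xu: "x \<in> carrier \<Gamma>" "u \<in> carrier \<Gamma>" using x u F G by auto
        then have ux: "ldist \<Gamma> L u x = real r" using True ldist_commute by metis
        obtain k where k: "k \<le> 2 * r" "L x + real k = L u + real r"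
          using ex_level_difference[OF xu ux] by blast
        have "g u \<le> ?t k" using g_le[OF u, of k] ux k(2) by (simp add: P_def)
        also have "\<dots> \<le> (\<Sum>k\<le>2*r. ?t k)"
          using k(1) nonneg by (intro member_le_sum) auto
        finally show ?thesis using True by simp
      qed (use nonneg in \<open>auto intro!: sum_nonneg\<close>)
    qed
    also have "\<dots> = ?low + ?high"
    proof -
      have "(\<Sum>x\<in>F. \<Sum>u\<in>G. \<Sum>k\<le>2*r. a k x u) = (\<Sum>k\<le>2*r. \<Sum>x\<in>F. \<Sum>u\<in>G. a k x u)"
        for a :: "nat \<Rightarrow> 'a \<Rightarrow> 'a \<Rightarrow> real"
      proof -
        have "(\<Sum>x\<in>F. \<Sum>u\<in>G. \<Sum>k\<le>2*r. a k x u) = (\<Sum>x\<in>F. \<Sum>k\<le>2*r. \<Sum>u\<in>G. a k x u)"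
          by (intro sum.cong refl sum.swap)
        also have "\<dots> = (\<Sum>k\<le>2*r. \<Sum>x\<in>F. \<Sum>u\<in>G. a k x u)" by (rule sum.swap)
        finally show ?thesis .
      qed
      then show ?thesis by (simp add: sum.distrib sum.swap[of _ F G])
    qed
    finally have split: "(\<Sum>x\<in>F. \<Sum>u \<in> {u \<in> G. ldist \<Gamma> L x u = real r}. g u) \<le> ?low + ?high" .
    have "?low \<le> (\<Sum>k\<le>2*r. real (card F) * (T k * (Cf * W * D / \<beta> ^ (4 * k))))"
    proof (rule sum_mono)
      fix k assume k: "k \<in> {..2*r}"
      have "(\<Sum>x\<in>F. \<Sum>u\<in>G. if P k x u then T k else 0) = (\<Sum>x\<in>F. T k * real (card {u \<in> G. P k x u}))"
        by (simp add: sum.inter_filter[OF G(1), symmetric] mult.commute)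
      also have "\<dots> \<le> (\<Sum>x\<in>F. T k * (Cf * W * D / \<beta> ^ (4 * k)))"
        using k T[of k] by (intro sum_mono mult_left_mono fibre_x) auto
      finally show "(\<Sum>x\<in>F. \<Sum>u\<in>G. if P k x u then T k else 0)
        \<le> real (card F) * (T k * (Cf * W * D / \<beta> ^ (4 * k)))" by simp
    qed
    also have "\<dots> = Cf * D * q ^ r * real (card F) * c * (\<Sum>k\<le>2*r. (\<beta>\<^sup>2) ^ k)"
    proof -
      have "T k * (Cf * W * D / \<beta> ^ (4 * k)) = Cf * D * q ^ r * c * (\<beta>\<^sup>2) ^ k" for k
      proof -
        have "\<beta> ^ (6 * k) = \<beta> ^ (4 * k) * (\<beta>\<^sup>2) ^ k"
          by (simp add: power_mult[symmetric] power_add[symmetric])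
        then show ?thesis using W \<beta> by (simp add: T_def)
      qed
      then show ?thesis by (simp add: sum_distrib_left mult_ac)
    qed
    also have "\<dots> \<le> Cf * D * q ^ r * real (card F) * c * (1 / (1 - \<beta>\<^sup>2))"
      using \<beta>2 Cf D qr c by (intro mult_left_mono sum_power_le) auto
    finally have low: "?low \<le> Cf * D * q ^ r * real (card F) * c * (1 / (1 - \<beta>\<^sup>2))" .
    have "?high \<le> (\<Sum>k\<le>2*r. \<Sum>u\<in>G. h k u * (Cf * W * D * (q ^ r * \<beta> ^ (4 * k))))"
    proof (intro sum_mono)
      fix k u assume k: "k \<in> {..2*r}" and u: "u \<in> G"
      have "(\<Sum>x\<in>F. if P k x u then h k u else 0) = h k u * real (card {x \<in> F. P k x u})"
        by (simp add: sum.inter_filter[OF F(1), symmetric] mult.commute)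
      then show "(\<Sum>x\<in>F. if P k x u then h k u else 0) \<le> h k u * (Cf * W * D * (q ^ r * \<beta> ^ (4 * k)))"
        using k fibre_u[OF u, of k] h_nonneg[OF u, of k] by (simp add: mult_left_mono)
    qed
    \<comment> \<open>One factor \<open>W\<close> comes from the fibre bound, and
      \<open>sqrt W\<close> from \<open>T k\<close> under the root.\<close>
    also have "\<dots> = Cf * W * D * q ^ r * (sqrt W / sqrt c) * S * (\<Sum>k\<le>2*r. \<beta> ^ k)"
    proof -
      have "h k u * (Cf * W * D * (q ^ r * \<beta> ^ (4 * k)))
          = Cf * W * D * q ^ r * (sqrt W / sqrt c) * (\<beta> ^ k * (g u * sqrt (g u / q ^ r)))" for k u
      proof -
        have 6: "\<beta> ^ (6 * k) = (\<beta> ^ (3 * k))\<^sup>2" by (simp add: power_mult[symmetric] mult.commute)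
        have "sqrt (g u / T k) = sqrt (g u / q ^ r) * sqrt W / (sqrt c * \<beta> ^ (3 * k))"
          using \<beta> by (simp add: T_def 6 real_sqrt_divide real_sqrt_mult)
        moreover have "\<beta> ^ (4 * k) = \<beta> ^ (3 * k) * \<beta> ^ k" by (simp add: power_add[symmetric])
        ultimately show ?thesis using \<beta> by (simp add: h_def)
      qed
      then have "(\<Sum>k\<le>2*r. \<Sum>u\<in>G. h k u * (Cf * W * D * (q ^ r * \<beta> ^ (4 * k))))
          = Cf * W * D * q ^ r * (sqrt W / sqrt c) * ((\<Sum>k\<le>2*r. \<beta> ^ k) * S)"
        unfolding S_def sum_product by (simp only: sum_distrib_left)
      then show ?thesis by (simp only: mult_ac)
    qed
    also have "\<dots> \<le> Cf * W * D * q ^ r * (sqrt W / sqrt c) * S * (1 / (1 - \<beta>))"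
      using \<beta> Cf W D qr c S by (intro mult_left_mono sum_power_le) auto
    finally have high: "?high \<le> Cf * W * D * q ^ r * (sqrt W / sqrt c) * S * (1 / (1 - \<beta>))" .
    have main: "D * q ^ r * real (card F)
      \<le> Cl * (Cf * D * q ^ r * real (card F) * c * (1 / (1 - \<beta>\<^sup>2))
           + Cf * W * D * q ^ r * (sqrt W / sqrt c) * S * (1 / (1 - \<beta>)))"
      using Cl(1) split low high by (intro order_trans[OF total] mult_left_mono) auto
    have half: "Cl * Cf * c * (1 / (1 - \<beta>\<^sup>2)) = 1 / 2"
      using \<beta>2 Cl(1) Cf by (simp add: c_def field_simps)
    have "D * q ^ r * real (card F)
        \<le> (Cl * Cf * c * (1 / (1 - \<beta>\<^sup>2))) * (D * q ^ r * real (card F)) + (D * q ^ r) * (C / 2 * (W * sqrt W) * S)"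
    proof -
      have "Cl * (Cf * W * D * q ^ r * (sqrt W / sqrt c) * S * (1 / (1 - \<beta>)))
          = (D * q ^ r) * (C / 2 * (W * sqrt W) * S)"
      proof -
        have "C / 2 = Cl * Cf / sqrt c * (1 / (1 - \<beta>))" unfolding C_def by simp
        then show ?thesis by (simp only: divide_inverse mult_ac)
      qed
      moreover have "Cl * (Cf * D * q ^ r * real (card F) * c * (1 / (1 - \<beta>\<^sup>2)))
          = (Cl * Cf * c * (1 / (1 - \<beta>\<^sup>2))) * (D * q ^ r * real (card F))"
        by (simp add: mult_ac)
      ultimately show ?thesis using main by (simp only: distrib_left)
    qed
    \<comment> \<open>The first summand is half of the left side and is moved over.\<close>
    then have "(D * q ^ r) * real (card F) \<le> (D * q ^ r) * (C * (W * sqrt W) * S)"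
      unfolding half by (simp add: mult.assoc)
    then have "real (card F) \<le> C * (W * sqrt W) * S"
      using D qr by (subst (asm) mult_le_cancel_left_pos) auto
    \<comment> \<open>Rounding the power 3/2 of \<open>W\<close> up to 2 is the source of the
      exponent \<open>2 * d2\<close>.\<close>
    also have "\<dots> \<le> C * (W * W) * S"
    proof -
      have "sqrt W \<le> W" using W by (intro real_le_lsqrt) (simp_all add: power2_eq_square)
      then show ?thesis using W S C by (intro mult_left_mono mult_right_mono) simp_all
    qed
    also have "W * W = max 1 (real r) powr (2 * d2)"
      by (simp only: W_def powr_add[symmetric] mult_2)
    finally show ?thesis by (simp add: F_def S_def)
  qed
  with C show ?thesis by (rule that)
qed

text \<open>The bound by \<open>g u * sqrt (g u / q ^ r)\<close> is too large while
  \<open>q ^ r\<close> is small: at \<open>r = 0\<close> it has order \<open>g u powr (3/2)\<close>.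
  Hence the points of \<open>G1\<close> are charged with their whole spheres. A heavy point on none
  of these spheres has the same sum over \<open>G2\<close> and stays heavy.\<close>

lemma card_heavy_split_le:
  obtains C where "C > 0"
    "\<And>r G g. finite G \<Longrightarrow> G \<subseteq> carrier \<Gamma> \<Longrightarrow> (\<And>u. u \<in> G \<Longrightarrow> g u \<ge> 1) \<Longrightarrow>
       real (card (heavy G g r)) \<le> (\<Sum>u\<in>G. if q ^ r \<le> g u then C * max 1 (real r) ^ d * q ^ r
        else C * max 1 (real r) powr (2 * d2) * (g u * sqrt (g u / q ^ r)))"
proof -
  obtain C1 where C1: "C1 > 0"
    "\<And>s. s \<ge> 0 \<Longrightarrow> real (card (lsphere \<Gamma> L s)) \<le> C1 * max 1 s ^ d * q powr s"
    using card_lsphere_le by blast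
  obtain C2 where C2: "C2 > 0" and bound: "\<And>r G g. finite G \<Longrightarrow> G \<subseteq> carrier \<Gamma> \<Longrightarrow> (\<And>u. u \<in> G \<Longrightarrow> g u > 0) \<Longrightarrow>
       real (card (heavy G g r)) \<le> C2 * max 1 (real r) powr (2 * d2) * (\<Sum>u\<in>G. g u * sqrt (g u / q ^ r))"
    by (fact card_heavy_le)
  define C where "C = C1 + C2"
  have C: "C > 0" "C1 \<le> C" "C2 \<le> C" using C1(1) C2 by (auto simp: C_def)
  have "real (card (heavy G g r)) \<le> (\<Sum>u\<in>G. if q ^ r \<le> g u then C * max 1 (real r) ^ d * q ^ r
        else C * max 1 (real r) powr (2 * d2) * (g u * sqrt (g u / q ^ r)))"
    if G: "finite G" "G \<subseteq> carrier \<Gamma>" and g: "\<And>u. u \<in> G \<Longrightarrow> g u \<ge> 1" for r G g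
  proof -
    let ?a = "C * max 1 (real r) ^ d * q ^ r"
    let ?b = "\<lambda>u. C * max 1 (real r) powr (2 * d2) * (g u * sqrt (g u / q ^ r))"
    define G1 where "G1 = {u \<in> G. q ^ r \<le> g u}"
    define G2 where "G2 = {u \<in> G. \<not> q ^ r \<le> g u}"
    have fin: "finite G1" "finite G2" and sub: "G1 \<subseteq> carrier \<Gamma>" "G2 \<subseteq> carrier \<Gamma>"
      using G by (auto simp: G1_def G2_def)
    have "heavy G g r \<subseteq> (\<Union>u\<in>G1. dist_eq u r) \<union> heavy G2 g r"
    proof
      fix x assume x: "x \<in> heavy G g r"
      show "x \<in> (\<Union>u\<in>G1. dist_eq u r) \<union> heavy G2 g r"
      proof (cases "x \<in> (\<Union>u\<in>G1. dist_eq u r)")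
        case False
        have xc: "x \<in> carrier \<Gamma>" using x by (simp add: heavy_def)
        have "u \<in> G2" if "u \<in> G" "ldist \<Gamma> L x u = real r" for u
        proof -
          have "u \<in> carrier \<Gamma>" using that G by blast
          then have "x \<in> dist_eq u r" using that xc ldist_commute[OF xc, of u] by simp
          then show ?thesis using that False by (auto simp: G1_def G2_def)
        qed
        then have "{u \<in> G. ldist \<Gamma> L x u = real r} = {u \<in> G2. ldist \<Gamma> L x u = real r}"
          by (auto simp: G2_def)
        then have "x \<in> heavy G2 g r" using x by (simp add: heavy_def)
        then show ?thesis by blast
      qed blast
    qed
    then have "card (heavy G g r) \<le> card ((\<Union>u\<in>G1. dist_eq u r) \<union> heavy G2 g r)"
      using fin sub finite_dist_eq finite_heavy[of G2 g r] by (intro card_mono) auto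
    also have "\<dots> \<le> (\<Sum>u\<in>G1. card (dist_eq u r)) + card (heavy G2 g r)"
      using card_UN_le[OF fin(1), of "\<lambda>u. dist_eq u r"]
      by (intro order_trans[OF card_Un_le] add_right_mono)
    finally have "real (card (heavy G g r))
        \<le> (\<Sum>u\<in>G1. real (card (dist_eq u r))) + real (card (heavy G2 g r))"
      by (simp only: of_nat_add[symmetric] of_nat_sum[symmetric] of_nat_le_iff)
    also have "\<dots> \<le> (\<Sum>u\<in>G1. ?a) + (\<Sum>u\<in>G2. ?b u)"
    proof (intro add_mono sum_mono)
      fix u assume "u \<in> G1"
      then have "real (card (dist_eq u r)) \<le> C1 * (max 1 (real r) ^ d * q ^ r)"
        using C1(2)[of "real r"] sub card_dist_eq[of u r] q by (auto simp: powr_realpow mult.assoc)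
      also have "\<dots> \<le> C * (max 1 (real r) ^ d * q ^ r)"
        using C q by (intro mult_right_mono) auto
      finally show "real (card (dist_eq u r)) \<le> ?a" by (simp only: mult.assoc)
    next
      have pos: "g u > 0" if "u \<in> G2" for u using g[of u] that by (auto simp: G2_def)
      have "real (card (heavy G2 g r)) \<le> C2 * max 1 (real r) powr (2 * d2) * (\<Sum>u\<in>G2. g u * sqrt (g u / q ^ r))"
        using bound[OF fin(2) sub(2) pos] .
      also have "\<dots> \<le> C * max 1 (real r) powr (2 * d2) * (\<Sum>u\<in>G2. g u * sqrt (g u / q ^ r))"
        using C q pos by (intro mult_right_mono sum_nonneg) (auto simp: less_imp_le)
      finally show "real (card (heavy G2 g r)) \<le> (\<Sum>u\<in>G2. ?b u)" by (simp only: sum_distrib_left)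
    qed
    also have "\<dots> = (\<Sum>u\<in>G. if q ^ r \<le> g u then ?a else ?b u)"
      using G(1) by (subst sum.If_cases) (auto simp: G1_def G2_def Int_def)
    finally show ?thesis .
  qed
  with C(1) show ?thesis by (rule that)
qed

text \<open>Spheres grow exponentially while the total mass of \<open>g\<close> is fixed. Only
  finitely many radii matter, so the sums over radii and over points can be exchanged.\<close>

lemma heavy_eventually_empty:
  assumes G: "finite G" and g: "\<And>u. u \<in> G \<Longrightarrow> g u \<ge> 0"
  obtains N where "\<And>r. N \<le> r \<Longrightarrow> heavy G g r = {}"
proof -
  obtain C where C: "C > 0"
    "\<And>n. max 1 (real n) ^ d * q ^ n \<le> C * real (card (lsphere \<Gamma> L (real n)))"
    using card_lsphere_ge by blast
  obtain N where N: "C * sum g G < q ^ N" using real_arch_pow[OF q] by blast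
  have "heavy G g r = {}" if "N \<le> r" for r
  proof (rule ccontr)
    assume "heavy G g r \<noteq> {}"
    then obtain x where x: "x \<in> heavy G g r" by blast
    have "q ^ N \<le> q ^ r" using q that by (intro power_increasing) auto
    also have "\<dots> \<le> max 1 (real r) ^ d * q ^ r"
      using q by simp
    also have "\<dots> \<le> C * real (card (lsphere \<Gamma> L (real r)))" by (rule C(2))
    also have "\<dots> \<le> C * (\<Sum>u \<in> {u \<in> G. ldist \<Gamma> L x u = real r}. g u)"
      using x C(1) by (intro mult_left_mono) (auto simp: heavy_def)
    also have "\<dots> \<le> C * sum g G"
      using C(1) G g by (intro mult_left_mono sum_mono2) auto
    finally show False using N by simp
  qed
  then show ?thesis by (rule that)
qed

lemma card_UN_heavy_le:
  obtains K where "K > 0"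
    "\<And>G g. finite G \<Longrightarrow> G \<subseteq> carrier \<Gamma> \<Longrightarrow> (\<And>u. u \<in> G \<Longrightarrow> g u \<ge> 1) \<Longrightarrow>
       finite (\<Union>r. heavy G g r) \<and>
       real (card (\<Union>r. heavy G g r)) \<le> K * (\<Sum>u\<in>G. g u * (1 + ln (g u)) powr (2 * d2 + real d))"
proof -
  obtain C where C: "C > 0" and split: "\<And>r G g. finite G \<Longrightarrow> G \<subseteq> carrier \<Gamma> \<Longrightarrow> (\<And>u. u \<in> G \<Longrightarrow> g u \<ge> 1) \<Longrightarrow>
       real (card (heavy G g r)) \<le> (\<Sum>u\<in>G. if q ^ r \<le> g u then C * max 1 (real r) ^ d * q ^ r
        else C * max 1 (real r) powr (2 * d2) * (g u * sqrt (g u / q ^ r)))"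
    by (fact card_heavy_split_le)
  have e: "0 \<le> 2 * d2" using d2 by simp
  obtain K where K: "K > 0" and radii: "\<And>t N. t \<ge> 1 \<Longrightarrow> (\<Sum>r<N. if q ^ r \<le> t then C * max 1 (real r) ^ d * q ^ r
        else C * max 1 (real r) powr (2 * d2) * (t * sqrt (t / q ^ r)))
      \<le> K * (t * (1 + ln t) powr (2 * d2 + real d))"
    by (fact sum_radii_le[OF q e C])
  have "finite (\<Union>r. heavy G g r) \<and>
       real (card (\<Union>r. heavy G g r)) \<le> K * (\<Sum>u\<in>G. g u * (1 + ln (g u)) powr (2 * d2 + real d))"
    if G: "finite G" "G \<subseteq> carrier \<Gamma>" and g: "\<And>u. u \<in> G \<Longrightarrow> g u \<ge> 1" for G g
  proof -
    have "g u \<ge> 0" if "u \<in> G" for u using g[OF that] by simp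
    then obtain N where N: "\<And>r. N \<le> r \<Longrightarrow> heavy G g r = {}"
      using heavy_eventually_empty[of G g] G(1) by blast
    have eq: "(\<Union>r. heavy G g r) = (\<Union>r<N. heavy G g r)"
    proof -
      have "r < N" if "x \<in> heavy G g r" for x r using N[of r] that by (cases "N \<le> r") auto
      then show ?thesis by blast
    qed
    have "card (\<Union>r<N. heavy G g r) \<le> (\<Sum>r<N. card (heavy G g r))" by (rule card_UN_le) simp
    then have "real (card (\<Union>r. heavy G g r)) \<le> (\<Sum>r<N. real (card (heavy G g r)))"
      by (simp only: eq of_nat_sum[symmetric] of_nat_le_iff)
    also have "\<dots> \<le> (\<Sum>r<N. \<Sum>u\<in>G. if q ^ r \<le> g u then C * max 1 (real r) ^ d * q ^ r
        else C * max 1 (real r) powr (2 * d2) * (g u * sqrt (g u / q ^ r)))"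
      by (intro sum_mono split G g)
    also have "\<dots> = (\<Sum>u\<in>G. \<Sum>r<N. if q ^ r \<le> g u then C * max 1 (real r) ^ d * q ^ r
        else C * max 1 (real r) powr (2 * d2) * (g u * sqrt (g u / q ^ r)))"
      by (rule sum.swap)
    also have "\<dots> \<le> (\<Sum>u\<in>G. K * (g u * (1 + ln (g u)) powr (2 * d2 + real d)))"
      by (intro sum_mono radii g)
    finally have "real (card (\<Union>r. heavy G g r)) \<le> K * (\<Sum>u\<in>G. g u * (1 + ln (g u)) powr (2 * d2 + real d))"
      by (simp only: sum_distrib_left)
    moreover have "finite (\<Union>r. heavy G g r)"
      unfolding eq using finite_heavy[OF G] by (intro finite_UN_I) auto
    ultimately show ?thesis by (rule conjI[rotated])
  qed
  with K show ?thesis by (rule that)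
qed

section \<open>From sphere averages to the maximal inequalities\<close>

text \<open>\<open>a\<close> is the height of truncation and \<delta> the unit in which the
  truncated function is measured; \<open>\<delta> \<le> a\<close> makes its values at least 1. Off
  the heavy sets the maximal function is at most \<open>a + \<delta>\<close>, hence below
  \<open>t\<close>.\<close>

lemma card_superlevel_le:
  assumes r0: "r0 > 0"
  obtains K where "K > 0"
    "\<And>f a \<delta> t. \<lbrakk>0 < \<delta>; \<delta> \<le> a; a + \<delta> < t; finite {u \<in> carrier \<Gamma>. a < cmod (f u)}\<rbrakk> \<Longrightarrow>
       finite (superlevel \<Gamma> L r0 f t) \<and>
       real (card (superlevel \<Gamma> L r0 f t))
         \<le> K * (\<Sum>u \<in> {u \<in> carrier \<Gamma>. a < cmod (f u)}.
                  cmod (f u) / \<delta> * (1 + ln (cmod (f u) / \<delta>)) powr (2 * d2 + real d))"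
proof -
  obtain K where K: "K > 0" and bound: "\<And>G g. finite G \<Longrightarrow> G \<subseteq> carrier \<Gamma> \<Longrightarrow> (\<And>u. u \<in> G \<Longrightarrow> g u \<ge> 1) \<Longrightarrow>
       finite (\<Union>r. heavy G g r) \<and>
       real (card (\<Union>r. heavy G g r)) \<le> K * (\<Sum>u\<in>G. g u * (1 + ln (g u)) powr (2 * d2 + real d))"
    by (fact card_UN_heavy_le)
  have "finite (superlevel \<Gamma> L r0 f t) \<and> real (card (superlevel \<Gamma> L r0 f t))
         \<le> K * (\<Sum>u \<in> {u \<in> carrier \<Gamma>. a < cmod (f u)}.
                  cmod (f u) / \<delta> * (1 + ln (cmod (f u) / \<delta>)) powr (2 * d2 + real d))"
    if \<delta>: "0 < \<delta>" "\<delta> \<le> a" and t: "a + \<delta> < t" and fin: "finite {u \<in> carrier \<Gamma>. a < cmod (f u)}"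
    for f a \<delta> t
  proof -
    define G where "G = {u \<in> carrier \<Gamma>. a < cmod (f u)}"
    define g where "g u = cmod (f u) / \<delta>" for u
    have b: "finite (\<Union>r. heavy G g r) \<and>
       real (card (\<Union>r. heavy G g r)) \<le> K * (\<Sum>u\<in>G. g u * (1 + ln (g u)) powr (2 * d2 + real d))"
      using fin \<delta> by (intro bound) (auto simp: G_def g_def)
    have sub: "superlevel \<Gamma> L r0 f t \<subseteq> (\<Union>r. heavy G g r)"
    proof
      fix x assume x: "x \<in> superlevel \<Gamma> L r0 f t"
      then have xc: "x \<in> carrier \<Gamma>" by (simp add: superlevel_def)
      show "x \<in> (\<Union>r. heavy G g r)"
      proof (rule ccontr)
        assume not: "x \<notin> (\<Union>r. heavy G g r)"
        have "HL_maximal \<Gamma> L r0 f x \<le> ennreal (a + \<delta>)"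
        proof (rule HL_maximal_le[OF xc r0 \<delta>(1) _ G_def])
          show "(\<Sum>u \<in> {u \<in> G. ldist \<Gamma> L x u = real n}. cmod (f u) / \<delta>)
                  < real (card (lsphere \<Gamma> L (real n)))" for n
            using not xc by (auto simp: heavy_def g_def not_le)
        qed (use \<delta> fin in \<open>auto simp: G_def\<close>)
        moreover have "ennreal t \<le> HL_maximal \<Gamma> L r0 f x" using x by (simp add: superlevel_def)
        ultimately have "ennreal t \<le> ennreal (a + \<delta>)" by (rule order_trans[rotated])
        then show False using t \<delta> by (simp add: ennreal_le_iff del: ennreal_plus)
      qed
    qed
    have "real (card (superlevel \<Gamma> L r0 f t)) \<le> real (card (\<Union>r. heavy G g r))"
      using b sub by (intro of_nat_mono card_mono) blast+
    also have "\<dots> \<le> K * (\<Sum>u\<in>G. g u * (1 + ln (g u)) powr (2 * d2 + real d))"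
      using b by (rule conjunct2)
    finally show ?thesis
      using finite_subset[OF sub conjunct1[OF b]] unfolding G_def g_def by (intro conjI)
  qed
  with K show ?thesis by (rule that)
qed

text \<open>Height and unit are both \<open>\<eta> / 4\<close>, with sum below \<eta>; for exponent
  0 the logarithm disappears.\<close>

lemma weak_type_1_1_if_parameters_zero:
  assumes r0: "r0 > 0" and "d2 = 0" "d = 0"
  shows "weak_type_1_1 \<Gamma> L r0"
proof -
  obtain K where K: "K > 0" and bound: "\<And>f a \<delta> t. \<lbrakk>0 < \<delta>; \<delta> \<le> a; a + \<delta> < t; finite {u \<in> carrier \<Gamma>. a < cmod (f u)}\<rbrakk> \<Longrightarrow>
       finite (superlevel \<Gamma> L r0 f t) \<and>
       real (card (superlevel \<Gamma> L r0 f t))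
         \<le> K * (\<Sum>u \<in> {u \<in> carrier \<Gamma>. a < cmod (f u)}.
                  cmod (f u) / \<delta> * (1 + ln (cmod (f u) / \<delta>)) powr (2 * d2 + real d))"
    by (fact card_superlevel_le[OF r0])
  have "finite (superlevel \<Gamma> L r0 f \<eta>) \<and>
        real (card (superlevel \<Gamma> L r0 f \<eta>)) \<le> (4 * K) / \<eta> * (\<Sum>\<^sub>\<infinity>x \<in> carrier \<Gamma>. cmod (f x))"
    if f: "(\<lambda>x. cmod (f x)) summable_on carrier \<Gamma>" and \<eta>: "\<eta> > 0" for f \<eta>
  proof -
    define G where "G = {u \<in> carrier \<Gamma>. \<eta> / 4 < cmod (f u)}"
    have G: "finite G" "G \<subseteq> carrier \<Gamma>"
    proof -
      show "G \<subseteq> carrier \<Gamma>" by (auto simp: G_def)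
      with f have "(\<lambda>x. cmod (f x)) summable_on G" by (rule summable_on_subset)
      then show "finite G"
        by (rule finite_if_summable_on_bounded_below[where c = "\<eta> / 4"]) (use \<eta> in \<open>auto simp: G_def\<close>)
    qed
    \<comment> \<open>Since \<open>0 powr 0 = 0\<close>, the base has to be shown nonzero.\<close>
    have powr_1: "(1 + ln (cmod (f u) / (\<eta> / 4))) powr (2 * d2 + real d) = 1" if "u \<in> G" for u
    proof -
      have "cmod (f u) / (\<eta> / 4) \<ge> 1" using that \<eta> by (simp add: G_def)
      then have "ln (cmod (f u) / (\<eta> / 4)) \<ge> 0" by (rule ln_ge_zero)
      then show ?thesis using assms by simp
    qed
    have *: "finite (superlevel \<Gamma> L r0 f \<eta>) \<and> real (card (superlevel \<Gamma> L r0 f \<eta>))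
         \<le> K * (\<Sum>u \<in> G. cmod (f u) / (\<eta> / 4) * (1 + ln (cmod (f u) / (\<eta> / 4))) powr (2 * d2 + real d))"
      unfolding G_def by (rule bound) (use \<eta> G in \<open>auto simp: G_def\<close>)
    also have "(\<Sum>u \<in> G. cmod (f u) / (\<eta> / 4) * (1 + ln (cmod (f u) / (\<eta> / 4))) powr (2 * d2 + real d))
        = 4 / \<eta> * (\<Sum>u \<in> G. cmod (f u))"
      unfolding sum_distrib_left by (intro sum.cong refl) (simp only: powr_1, simp)
    finally have **: "finite (superlevel \<Gamma> L r0 f \<eta>) \<and> real (card (superlevel \<Gamma> L r0 f \<eta>))
         \<le> K * (4 / \<eta> * (\<Sum>u \<in> G. cmod (f u)))" .
    have "K * (4 / \<eta> * (\<Sum>u \<in> G. cmod (f u))) \<le> K * (4 / \<eta> * (\<Sum>\<^sub>\<infinity>x \<in> carrier \<Gamma>. cmod (f x)))"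
      using K \<eta> by (intro mult_left_mono finite_sum_le_infsum f G) auto
    with ** show ?thesis by (simp add: mult_ac)
  qed
  moreover have "4 * K > 0" using K by simp
  ultimately show ?thesis unfolding weak_type_1_1_def by blast
qed

text \<open>Truncating at \<open>(1 + e) * \<eta>\<close> instead of \<eta> keeps
  \<open>ln (cmod (f u) / \<eta>)\<close> at least \<open>ln (1 + e)\<close> on \<open>G\<close>. So
  the summands are bounded below, which makes \<open>G\<close> finite, and the logarithm absorbs
  additive constants. The price is that the threshold must exceed
  \<open>(1 + 2 * e) * \<eta>\<close>.\<close>

lemma LlogL_bound_ex:
  assumes r0: "r0 > 0" and lam: "lam > 1"
  shows "\<exists>K>0. LlogL_bound \<Gamma> L r0 (2 * d2 + real d) lam K"
proof -
  define c where "c = 2 * d2 + real d"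
  obtain K where K: "K > 0" and bound: "\<And>f a \<delta> t. \<lbrakk>0 < \<delta>; \<delta> \<le> a; a + \<delta> < t; finite {u \<in> carrier \<Gamma>. a < cmod (f u)}\<rbrakk> \<Longrightarrow>
       finite (superlevel \<Gamma> L r0 f t) \<and>
       real (card (superlevel \<Gamma> L r0 f t))
         \<le> K * (\<Sum>u \<in> {u \<in> carrier \<Gamma>. a < cmod (f u)}.
                  cmod (f u) / \<delta> * (1 + ln (cmod (f u) / \<delta>)) powr c)"
    unfolding c_def by (fact card_superlevel_le[OF r0])
  have c: "c \<ge> 0" using d2 by (simp add: c_def)
  \<comment> \<open>A third of \<open>lam - 1\<close> fits twice strictly below
    \<open>lam - 1\<close>; the cap at 1 gives \<open>ln (1 / e) \<ge> 0\<close>.\<close>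
  define e where "e = min 1 ((lam - 1) / 3)"
  have e: "0 < e" "e \<le> 1" "1 + e + e < lam" using lam by (auto simp: e_def min_def field_simps)
  have lne: "ln (1 + e) > 0" using e by simp
  define M where "M = (1 + ln (1 / e)) / ln (1 + e) + 1"
  have le1: "1 + ln (1 / e) > 0"
  proof -
    have "1 / e \<ge> 1" using e by simp
    then have "ln (1 / e) \<ge> 0" by (rule ln_ge_zero)
    then show ?thesis by simp
  qed
  have M: "M > 0" using le1 lne by (simp add: M_def add_pos_pos)
  have "finite (superlevel \<Gamma> L r0 f (lam * \<eta>)) \<and>
        real (card (superlevel \<Gamma> L r0 f (lam * \<eta>))) \<le>
          (K * M powr c / e) * (\<Sum>\<^sub>\<infinity>x \<in> {x \<in> carrier \<Gamma>. cmod (f x) > \<eta>}.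
                 cmod (f x) / \<eta> * ln (cmod (f x) / \<eta>) powr c)"
    if f: "f \<in> LlogL \<Gamma> c" and \<eta>: "\<eta> > 0" for f \<eta>
  proof -
    define A where "A = {x \<in> carrier \<Gamma>. cmod (f x) > \<eta>}"
    define G where "G = {u \<in> carrier \<Gamma>. (1 + e) * \<eta> < cmod (f u)}"
    define h where "h x = cmod (f x) / \<eta> * ln (cmod (f x) / \<eta>) powr c" for x
    have hA: "h summable_on A" using f \<eta> by (simp add: LlogL_def h_def[abs_def] A_def)
    have GA: "G \<subseteq> A"
    proof
      fix u assume "u \<in> G"
      moreover have "\<eta> \<le> (1 + e) * \<eta>" using e \<eta> by simp
      ultimately show "u \<in> A" by (simp add: G_def A_def)
    qed
    have big: "1 + e \<le> cmod (f u) / \<eta>" if "u \<in> G" for u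
      using that \<eta> by (simp add: G_def field_simps)
    have ln_big: "ln (1 + e) \<le> ln (cmod (f u) / \<eta>)" if "u \<in> G" for u
      using big[OF that] e by (subst ln_le_cancel_iff) auto
    have h_ge: "ln (1 + e) powr c \<le> h u" if "u \<in> G" for u
    proof -
      have "1 * ln (1 + e) powr c \<le> h u"
        unfolding h_def using big[OF that] ln_big[OF that] e lne c
        by (intro mult_mono powr_mono2) auto
      then show ?thesis by simp
    qed
    have finG: "finite G"
    proof (rule finite_if_summable_on_bounded_below)
      show "h summable_on G" using hA GA by (rule summable_on_subset)
      show "ln (1 + e) powr c > 0" using lne by simp
    qed (rule h_ge)
    have term_le: "cmod (f u) / (e * \<eta>) * (1 + ln (cmod (f u) / (e * \<eta>))) powr c \<le> M powr c / e * h u"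
      if u: "u \<in> G" for u
    proof -
      define t where "t = cmod (f u) / \<eta>"
      have t: "1 + e \<le> t" "ln (1 + e) \<le> ln t" using big[OF u] ln_big[OF u] by (auto simp: t_def)
      have lt: "ln t > 0" using t lne by linarith
      have te: "cmod (f u) / (e * \<eta>) = t / e" by (simp add: t_def)
      \<comment> \<open>The factor 1 is written out because it is then replaced by
        \<open>ln t / ln (1 + e)\<close>, which is at least 1; this determines
        \<open>M\<close>.\<close>
      have "1 + ln (t / e) = (1 + ln (1 / e)) * 1 + ln t" using t e by (simp add: ln_div)
      also have "\<dots> \<le> (1 + ln (1 / e)) * (ln t / ln (1 + e)) + ln t"
        using t le1 lne by (intro add_right_mono mult_left_mono) auto
      also have "\<dots> = M * ln t" by (simp add: M_def algebra_simps)
      finally have "1 + ln (t / e) \<le> M * ln t" .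
      moreover have "1 + ln (t / e) \<ge> 0" using t e lt le1 by (simp add: ln_div)
      ultimately have "(1 + ln (t / e)) powr c \<le> (M * ln t) powr c" using c by (intro powr_mono2) auto
      also have "\<dots> = M powr c * ln t powr c" using M lt by (simp add: powr_mult)
      finally have "t / e * (1 + ln (t / e)) powr c \<le> t / e * (M powr c * ln t powr c)"
        using t e by (intro mult_left_mono) auto
      then show ?thesis unfolding te h_def t_def[symmetric] by (simp add: mult_ac)
    qed
    have \<delta>: "e * \<eta> \<le> (1 + e) * \<eta>" and thr: "(1 + e) * \<eta> + e * \<eta> < lam * \<eta>"
      using e \<eta> mult_strict_right_mono[OF e(3) \<eta>] by (simp_all add: algebra_simps)
    have *: "finite (superlevel \<Gamma> L r0 f (lam * \<eta>)) \<and> real (card (superlevel \<Gamma> L r0 f (lam * \<eta>)))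
         \<le> K * (\<Sum>u \<in> G. cmod (f u) / (e * \<eta>) * (1 + ln (cmod (f u) / (e * \<eta>))) powr c)"
      unfolding G_def by (rule bound) (use e \<eta> \<delta> thr finG in \<open>auto simp: G_def\<close>)
    have "K * (\<Sum>u \<in> G. cmod (f u) / (e * \<eta>) * (1 + ln (cmod (f u) / (e * \<eta>))) powr c)
        \<le> K * (\<Sum>u\<in>G. M powr c / e * h u)"
      using K by (intro mult_left_mono sum_mono term_le) auto
    also have "\<dots> = K * M powr c / e * sum h G" by (simp only: sum_distrib_left[symmetric]) simp
    also have "\<dots> \<le> K * M powr c / e * infsum h A"
    proof (intro mult_left_mono finite_sum_le_infsum hA finG GA)
      show "0 \<le> h x" if "x \<in> A - G" for x using \<eta> by (simp add: h_def)
    qed (use K e in auto)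
    finally show ?thesis using * unfolding A_def h_def[abs_def] by linarith
  qed
  moreover have "K * M powr c / e > 0" using K M e by simp
  ultimately show ?thesis unfolding LlogL_bound_def c_def by blast
qed

end

theorem theorem18:
  fixes \<Gamma> :: "('a, 'b) monoid_scheme"
    and L :: "'a \<Rightarrow> real"
    and q d2 r0 :: real
    and d :: nat
  assumes "group \<Gamma>"
    and "countable (carrier \<Gamma>)"
    and "length_function \<Gamma> L"
    and "\<forall>u\<in>carrier \<Gamma>. L u \<in> \<int>"
    and "d2 \<ge> 0"
    and "spherical_coarse_median \<Gamma> L d2"
    and "q > 1"
    and "almost_exact_growth \<Gamma> L q d"
    and "r0 > 0"
  shows "weak_type_LlogL \<Gamma> L r0 (2 * d2 + real d) \<and>
         (d2 = 0 \<and> d = 0 \<longrightarrow> weak_type_1_1 \<Gamma> L r0)"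
proof -
  interpret group \<Gamma> by fact
  interpret median_growth_group \<Gamma> L q d2 d
    by unfold_locales (use assms in auto)
  \<comment> \<open>Nonnegativity of \<open>d2\<close> makes the exponent vanish exactly when both
    parameters do, which selects the branch of \<open>weak_type_LlogL\<close>.\<close>
  have "2 * d2 + real d = 0 \<longleftrightarrow> d2 = 0 \<and> d = 0" using assms(5) by linarith
  then show ?thesis
    using weak_type_1_1_if_parameters_zero LlogL_bound_ex assms(9) by (auto simp: weak_type_LlogL_def)
qed

end
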